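(* Let $\lambda\in X$ be a dominant weight with stabilizer $W_J$, let $\mu\in X^0_{\mathrm{af}}(\lambda)$, and let $w:=\mathrm{cl}(\mu)\in W^J$ (under the identification $W\lambda\simeq W^J$). (a) If $\mu\lessdot\nu$ is a cover in the level-zero weight poset $X^0_{\mathrm{af}}(\lambda)$, then its label $\beta$ lies in $\Phi^+$ or in $\delta-\Phi^+$. Moreover, if $\beta\in\Phi^+$ then $w\to\mathrm{cl}(\nu)$ is an up (Bruhat) edge in $\mathrm{QB}(W^J)$ labeled by $w^{-1}(\beta)\in\Phi^+\setminus\Phi_J^+$, and if $\beta\in\delta-\Phi^+$ then $w\to\mathrm{cl}(\nu)$ is a down (quantum) edge in $\mathrm{QB}(W^J)$ labeled by $w^{-1}(\beta-\delta)\in\Phi^+\setminus\Phi_J^+$. (b) Conversely, let $\gamma\in\Phi^+\setminus\Phi_J^+$. If $w\xrightarrow{\gamma}wr_\gamma=w'$ is a Bruhat edge (respectively $w\xrightarrow{\gamma}\lfloor wr_\gamma\rfloor=w'$ is a quantum edge) in $\mathrm{QB}(W^J)$, then there exists a cover $\mu\lessdot\nu$ in $X^0_{\mathrm{af}}(\lambda)$ labeled by $w(\gamma)$ (respectively by $\delta+w(\gamma)$) with $\mathrm{cl}(\nu)=w'$.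
   Context: Let $\mathfrak g$ be a finite-dimensional simple Lie algebra with roots $\Phi\supset\Phi^+$, weight lattice $X$, Weyl group $W$ (reflections $r_\alpha$, length $\ell$), and $\rho$ half the sum of the positive roots. Let $\mathfrak g_{\mathrm{af}}$ be the associated untwisted affine algebra with null root $\delta$ and affine Weyl group $W_{\mathrm{af}}$. The real affine roots are $\Phi^{\mathrm{af}}=\{\alpha+n\delta:\alpha\in\Phi,n\in\mathbb Z\}$ and the positive ones are $\Phi^{\mathrm{af}+}=\Phi^+\cup\{\alpha+n\delta:\alpha\in\Phi,n>0\}$. The lattice of level-zero affine weights, taken modulo nothing, is $X\oplus\mathbb Z\delta$ (with $\omega_i\in X$ viewed as $\Lambda_i-\langle c,\Lambda_i\rangle\Lambda_0$, $c$ the canonical central element); on it $\langle(\alpha+n\delta)^\vee,\mu\rangle=\langle\alpha^\vee,\mathrm{cl}(\mu)\rangle$ and $r_{\alpha+n\delta}(\mu)=\mu-\langle\alpha^\vee,\mathrm{cl}(\mu)\rangle(\alpha+n\delta)$, where $\mathrm{cl}:X\oplus\mathbb Z\delta\to X$ is the projection killing $\delta$. Fix a dominant $\lambda\in X$; $J=\{i:\langle\alpha_i^\vee,\lambda\rangle=0\}$, $W_J$ is the stabilizer of $\lambda$ in $W$ (generated by $r_i$, $i\in J$), $\Phi_J^+$ its positive roots, $\rho_J$ half their sum, $W^J$ the minimal-length representatives of $W/W_J$, $\lfloor v\rfloor$ the minimal-length element of $vW_J$. Level-zero weight poset: $X^0_{\mathrm{af}}(\lambda)=W_{\mathrm{af}}\lambda$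 with the partial order that is the transitive closure of the relations $\mu<r_\beta(\mu)$ whenever $\beta\in\Phi^{\mathrm{af}+}$ and $\langle\beta^\vee,\mu\rangle>0$. A cover $\mu\lessdot\nu$ has the form $\nu=r_\beta(\mu)$ with a unique $\beta\in\Phi^{\mathrm{af}+}$, called its label. The map $\mathrm{cl}$ sends $X^0_{\mathrm{af}}(\lambda)$ to $W\lambda$, which is identified with $W^J$ via $w\lambda\leftrightarrow w$. Parabolic quantum Bruhat graph $\mathrm{QB}(W^J)$: the directed graph with vertex set $W^J$ and edges $w\xrightarrow{\gamma}\lfloor wr_\gamma\rfloor$ for $w\in W^J$, $\gamma\in\Phi^+\setminus\Phi_J^+$ such that either (Bruhat, or up, edge) $wr_\gamma$ covers $w$ in Bruhat order (then $wr_\gamma\in W^J$), or (quantum, or down, edge) $\ell(\lfloor wr_\gamma\rfloor)=\ell(w)+1-\langle\gamma^\vee,2\rho-2\rho_J\rangle$. *)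

theory Defs
  imports "HOL-Analysis.Analysis"
begin

text \<open>
  The simple Lie algebra enters only through its root system, which is given abstractly as an
  irreducible reduced crystallographic root system \<open>\<Phi>\<close> spanning a Euclidean space, together with
  a set \<open>\<Delta>\<close> of simple roots; a simple root \<open>\<alpha>\<^sub>i\<close> serves as its own index \<open>i\<close>.
\<close>

section \<open>Finite root systems and Weyl groups\<close>

text \<open>\<open>pairing \<alpha> x\<close> is \<open>\<langle>\<alpha>\<^sup>\<or>, x\<rangle>\<close>.\<close>

definition pairing :: "'a::euclidean_space \<Rightarrow> 'a \<Rightarrow> real" where
  "pairing \<alpha> x = 2 * (\<alpha> \<bullet> x) / (\<alpha> \<bullet> \<alpha>)"

definition refl :: "'a::euclidean_space \<Rightarrow> 'a \<Rightarrow> 'a" where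
  "refl \<alpha> x = x - pairing \<alpha> x *\<^sub>R \<alpha>"

definition irreducible_root_system :: "'a::euclidean_space set \<Rightarrow> bool" where
  "irreducible_root_system \<Phi> \<longleftrightarrow>
     finite \<Phi> \<and> 0 \<notin> \<Phi> \<and> span \<Phi> = UNIV \<and>
     (\<forall>\<alpha>\<in>\<Phi>. \<forall>\<beta>\<in>\<Phi>. refl \<alpha> \<beta> \<in> \<Phi>) \<and>
     (\<forall>\<alpha>\<in>\<Phi>. \<forall>\<beta>\<in>\<Phi>. pairing \<alpha> \<beta> \<in> \<int>) \<and>
     (\<forall>\<alpha>\<in>\<Phi>. \<forall>c. c *\<^sub>R \<alpha> \<in> \<Phi> \<longrightarrow> c = 1 \<or> c = -1) \<and>
     \<not> (\<exists>A B. A \<noteq> {} \<and> B \<noteq> {} \<and> A \<union> B = \<Phi> \<and> (\<forall>\<alpha>\<in>A. \<forall>\<beta>\<in>B. \<alpha> \<bullet> \<beta> = 0))"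

text \<open>
  The roots that are nonnegative integer combinations of \<open>S\<close>: for \<open>S = \<Delta>\<close> this is \<open>\<Phi>\<^sup>+\<close>, and for
  \<open>S = J \<subseteq> \<Delta>\<close> it is the set \<open>\<Phi>\<^sub>J\<^sup>+\<close> of positive roots of the parabolic subgroup \<open>W\<^sub>J\<close>.
\<close>

definition pos_roots :: "'a::euclidean_space set \<Rightarrow> 'a set \<Rightarrow> 'a set" where
  "pos_roots \<Phi> S = {\<beta> \<in> \<Phi>. \<exists>c :: 'a \<Rightarrow> nat. \<beta> = (\<Sum>\<alpha>\<in>S. real (c \<alpha>) *\<^sub>R \<alpha>)}"

definition simple_roots :: "'a::euclidean_space set \<Rightarrow> 'a set \<Rightarrow> bool" where
  "simple_roots \<Phi> \<Delta> \<longleftrightarrow>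
     \<Delta> \<subseteq> \<Phi> \<and> independent \<Delta> \<and> (\<forall>\<beta>\<in>\<Phi>. \<beta> \<in> pos_roots \<Phi> \<Delta> \<or> - \<beta> \<in> pos_roots \<Phi> \<Delta>)"

definition half_sum :: "'a::euclidean_space set \<Rightarrow> 'a" where
  "half_sum P = (1 / 2) *\<^sub>R (\<Sum>\<alpha>\<in>P. \<alpha>)"

definition weight_lattice :: "'a::euclidean_space set \<Rightarrow> 'a set" where
  "weight_lattice \<Phi> = {x. \<forall>\<alpha>\<in>\<Phi>. pairing \<alpha> x \<in> \<int>}"

definition dominant :: "'a::euclidean_space set \<Rightarrow> 'a \<Rightarrow> bool" where
  "dominant \<Delta> x \<longleftrightarrow> (\<forall>\<alpha>\<in>\<Delta>. 0 \<le> pairing \<alpha> x)"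

definition word :: "('b \<Rightarrow> 'v \<Rightarrow> 'v) \<Rightarrow> 'b list \<Rightarrow> 'v \<Rightarrow> 'v" where
  "word r as = foldr (\<lambda>\<alpha> f. r \<alpha> \<circ> f) as id"

text \<open>
  The group generated by the maps \<open>r \<alpha>\<close> for \<open>\<alpha> \<in> S\<close>. Words in the generators suffice, because this
  is only used for reflections, which are their own inverses.
\<close>

definition generated_group :: "('b \<Rightarrow> 'v \<Rightarrow> 'v) \<Rightarrow> 'b set \<Rightarrow> ('v \<Rightarrow> 'v) set" where
  "generated_group r S = {word r as | as. set as \<subseteq> S}"

definition weyl_group :: "'a::euclidean_space set \<Rightarrow> ('a \<Rightarrow> 'a) set" where
  "weyl_group \<Phi> = generated_group refl \<Phi>"

definition len :: "'a::euclidean_space set \<Rightarrow> ('a \<Rightarrow> 'a) \<Rightarrow> nat" where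
  "len \<Delta> w = (LEAST n. \<exists>as. set as \<subseteq> \<Delta> \<and> length as = n \<and> w = word refl as)"

section \<open>Parabolic quotients and the parabolic quantum Bruhat graph\<close>

definition singular_nodes :: "'a::euclidean_space set \<Rightarrow> 'a \<Rightarrow> 'a set" where
  "singular_nodes \<Delta> lam = {\<alpha> \<in> \<Delta>. pairing \<alpha> lam = 0}"

text \<open>For \<open>J = singular_nodes \<Delta> lam\<close> with \<open>lam\<close> dominant, this is the stabilizer of \<open>lam\<close> in \<open>W\<close>.\<close>

definition parabolic :: "'a::euclidean_space set \<Rightarrow> ('a \<Rightarrow> 'a) set" where
  "parabolic J = generated_group refl J"

definition min_reps ::
  "'a::euclidean_space set \<Rightarrow> 'a set \<Rightarrow> 'a set \<Rightarrow> ('a \<Rightarrow> 'a) set" where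
  "min_reps \<Phi> \<Delta> J = {w \<in> weyl_group \<Phi>. \<forall>u\<in>parabolic J. len \<Delta> w \<le> len \<Delta> (w \<circ> u)}"

text \<open>The minimal-length element \<open>\<lfloor>v\<rfloor>\<close> of the coset \<open>v W\<^sub>J\<close>.\<close>

definition min_rep ::
  "'a::euclidean_space set \<Rightarrow> 'a set \<Rightarrow> 'a set \<Rightarrow> ('a \<Rightarrow> 'a) \<Rightarrow> ('a \<Rightarrow> 'a)" where
  "min_rep \<Phi> \<Delta> J v = (THE w. w \<in> min_reps \<Phi> \<Delta> J \<and> (\<exists>u\<in>parabolic J. w = v \<circ> u))"

definition covers :: "('b \<Rightarrow> 'b \<Rightarrow> bool) \<Rightarrow> 'b \<Rightarrow> 'b \<Rightarrow> bool" where
  "covers lt x y \<longleftrightarrow> lt x y \<and> \<not> (\<exists>z. lt x z \<and> lt z y)"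

definition bruhat_less ::
  "'a::euclidean_space set \<Rightarrow> 'a set \<Rightarrow> ('a \<Rightarrow> 'a) \<Rightarrow> ('a \<Rightarrow> 'a) \<Rightarrow> bool" where
  "bruhat_less \<Phi> \<Delta> =
     (\<lambda>u v. u \<in> weyl_group \<Phi> \<and> (\<exists>\<alpha>\<in>\<Phi>. v = u \<circ> refl \<alpha>) \<and> len \<Delta> u < len \<Delta> v)\<^sup>+\<^sup>+"

text \<open>
  The endpoint is written \<open>\<lfloor>w r\<^sub>\<gamma>\<rfloor>\<close> for both kinds of edges; in the Bruhat case \<open>w r\<^sub>\<gamma>\<close> itself lies
  in \<open>W\<^sup>J\<close>, so that the endpoint is \<open>w r\<^sub>\<gamma>\<close>.
\<close>

definition qb_edge_up ::
  "'a::euclidean_space set \<Rightarrow> 'a set \<Rightarrow> 'a set \<Rightarrow> ('a \<Rightarrow> 'a) \<Rightarrow> 'a \<Rightarrow> ('a \<Rightarrow> 'a) \<Rightarrow> bool" where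
  "qb_edge_up \<Phi> \<Delta> J w \<gamma> w' \<longleftrightarrow>
     w \<in> min_reps \<Phi> \<Delta> J \<and> \<gamma> \<in> pos_roots \<Phi> \<Delta> - pos_roots \<Phi> J \<and>
     w' = min_rep \<Phi> \<Delta> J (w \<circ> refl \<gamma>) \<and>
     covers (bruhat_less \<Phi> \<Delta>) w (w \<circ> refl \<gamma>)"

definition qb_edge_down ::
  "'a::euclidean_space set \<Rightarrow> 'a set \<Rightarrow> 'a set \<Rightarrow> ('a \<Rightarrow> 'a) \<Rightarrow> 'a \<Rightarrow> ('a \<Rightarrow> 'a) \<Rightarrow> bool" where
  "qb_edge_down \<Phi> \<Delta> J w \<gamma> w' \<longleftrightarrow>
     w \<in> min_reps \<Phi> \<Delta> J \<and> \<gamma> \<in> pos_roots \<Phi> \<Delta> - pos_roots \<Phi> J \<and>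
     w' = min_rep \<Phi> \<Delta> J (w \<circ> refl \<gamma>) \<and>
     real (len \<Delta> w') = real (len \<Delta> w) + 1 -
       pairing \<gamma> (2 *\<^sub>R half_sum (pos_roots \<Phi> \<Delta>) - 2 *\<^sub>R half_sum (pos_roots \<Phi> J))"

section \<open>Level-zero affine weights\<close>

text \<open>
  The pair \<open>(x, m)\<close> stands for \<open>x + m\<delta>\<close>. The coefficient of \<open>\<delta>\<close> is taken in the reals, so that the
  affine reflections are given by the usual linear formula; they preserve the lattice of pairs with
  \<open>x \<in> X\<close> and integral \<open>m\<close>, so the orbits of weights \<open>(lam, 0)\<close> with \<open>lam \<in> X\<close> lie in that lattice.
\<close>

definition fin :: "'a::euclidean_space \<Rightarrow> 'a \<times> real" where
  "fin x = (x, 0)"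

definition null_root :: "'a::euclidean_space \<times> real" ("\<delta>") where
  "\<delta> = (0, 1)"

definition cl :: "'a::euclidean_space \<times> real \<Rightarrow> 'a" where
  "cl \<mu> = fst \<mu>"

definition af_roots :: "'a::euclidean_space set \<Rightarrow> ('a \<times> real) set" where
  "af_roots \<Phi> = {fin \<alpha> + of_int n *\<^sub>R \<delta> | \<alpha> n. \<alpha> \<in> \<Phi>}"

definition af_pos_roots :: "'a::euclidean_space set \<Rightarrow> 'a set \<Rightarrow> ('a \<times> real) set" where
  "af_pos_roots \<Phi> \<Delta> =
     fin ` pos_roots \<Phi> \<Delta> \<union> {fin \<alpha> + of_int n *\<^sub>R \<delta> | \<alpha> n. \<alpha> \<in> \<Phi> \<and> n > 0}"

definition af_pairing :: "'a::euclidean_space \<times> real \<Rightarrow> 'a \<times> real \<Rightarrow> real" where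
  "af_pairing \<beta> \<mu> = pairing (cl \<beta>) (cl \<mu>)"

definition af_refl :: "'a::euclidean_space \<times> real \<Rightarrow> 'a \<times> real \<Rightarrow> 'a \<times> real" where
  "af_refl \<beta> \<mu> = \<mu> - af_pairing \<beta> \<mu> *\<^sub>R \<beta>"

definition af_weyl_group :: "'a::euclidean_space set \<Rightarrow> ('a \<times> real \<Rightarrow> 'a \<times> real) set" where
  "af_weyl_group \<Phi> = generated_group af_refl (af_roots \<Phi>)"

definition lz_weights :: "'a::euclidean_space set \<Rightarrow> 'a \<Rightarrow> ('a \<times> real) set" where
  "lz_weights \<Phi> lam = {g (fin lam) | g. g \<in> af_weyl_group \<Phi>}"

definition lz_less ::
  "'a::euclidean_space set \<Rightarrow> 'a set \<Rightarrow> 'a \<Rightarrow> 'a \<times> real \<Rightarrow> 'a \<times> real \<Rightarrow> bool" where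
  "lz_less \<Phi> \<Delta> lam =
     (\<lambda>\<mu> \<nu>. \<mu> \<in> lz_weights \<Phi> lam \<and>
        (\<exists>\<beta>\<in>af_pos_roots \<Phi> \<Delta>. af_pairing \<beta> \<mu> > 0 \<and> \<nu> = af_refl \<beta> \<mu>))\<^sup>+\<^sup>+"

definition lz_cover ::
  "'a::euclidean_space set \<Rightarrow> 'a set \<Rightarrow> 'a \<Rightarrow> 'a \<times> real \<Rightarrow> 'a \<times> real \<Rightarrow> bool" where
  "lz_cover \<Phi> \<Delta> lam = covers (lz_less \<Phi> \<Delta> lam)"

text \<open>The label of a cover \<open>\<mu> \<lessdot> \<nu>\<close>.\<close>

definition cover_label ::
  "'a::euclidean_space set \<Rightarrow> 'a set \<Rightarrow> 'a \<times> real \<Rightarrow> 'a \<times> real \<Rightarrow> 'a \<times> real" where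
  "cover_label \<Phi> \<Delta> \<mu> \<nu> = (THE \<beta>. \<beta> \<in> af_pos_roots \<Phi> \<Delta> \<and> \<nu> = af_refl \<beta> \<mu>)"

text \<open>\<open>cl \<mu>\<close> read as an element of \<open>W\<^sup>J\<close> under the identification \<open>w lam \<leftrightarrow> w\<close>.\<close>

definition cl_rep ::
  "'a::euclidean_space set \<Rightarrow> 'a set \<Rightarrow> 'a \<Rightarrow> 'a \<times> real \<Rightarrow> ('a \<Rightarrow> 'a)" where
  "cl_rep \<Phi> \<Delta> lam \<mu> =
     (THE w. w \<in> min_reps \<Phi> \<Delta> (singular_nodes \<Delta> lam) \<and> w lam = cl \<mu>)"

end

theory Submission
  imports Defs
begin

text \<open>
  For a vector \<open>x\<close> let \<open>L x\<close> count the positive roots that are negative on \<open>x\<close>, and let \<open>R x\<close> be the sum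
  of all roots that are negative on \<open>x\<close>. For \<open>x = w lam\<close> with \<open>w \<in> W\<^sup>J\<close> these are \<open>\<ell>(w)\<close> and
  \<open>- w (2\<rho> - 2\<rho>\<^sub>J)\<close>, so that both kinds of edges \<open>w \<rightarrow> \<lfloor>w r\<^sub>\<gamma>\<rfloor>\<close> say that
  \<open>T x (\<alpha> + n\<delta>) = L (r\<^sub>\<alpha> x) - L x - n \<langle>\<alpha>\<^sup>\<or>, R x\<rangle>\<close> equals \<open>1\<close>, where \<open>\<alpha> = w \<gamma>\<close>, with \<open>n = 0\<close> for up
  edges and \<open>n = 1\<close> for down edges.

  For a positive affine root \<open>\<beta>\<close> with \<open>\<langle>\<beta>\<^sup>\<or>, \<mu>\<rangle> > 0\<close> one has \<open>T (cl \<mu>) \<beta> \<ge> 1\<close>, with equality exactly if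
  \<open>\<mu> < r\<^sub>\<beta> \<mu>\<close> is a cover. This goes by descent on \<open>\<beta>\<close>: pick a simple affine root \<open>s\<close> with
  \<open>\<langle>s\<^sup>\<or>, \<beta>\<rangle> > 0\<close>. If \<open>s\<close> has the same strict sign on \<open>\<mu>\<close> and \<open>r\<^sub>\<beta> \<mu>\<close>, then applying \<open>r\<^sub>s\<close> changes
  neither \<open>T\<close> nor the cover property and makes \<open>\<beta>\<close> smaller; otherwise \<open>r\<^sub>s\<close> produces an intermediate
  element, and \<open>T\<close> exceeds its value after applying \<open>r\<^sub>s\<close>. Since \<open>T\<close> is strictly increasing in \<open>n\<close>,
  a cover has the smallest \<open>n\<close> for which \<open>\<alpha> + n\<delta>\<close> is positive. The same argument for the finite
  system, at a regular dominant vector, describes the covers of the Bruhat order.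
\<close>

section \<open>Reflections\<close>

lemma pairing_add: "pairing a (x + y) = pairing a x + pairing a y"
  by (simp add: pairing_def inner_add_right distrib_left add_divide_distrib)

lemma pairing_scaleR: "pairing a (c *\<^sub>R x) = c * pairing a x"
  by (simp add: pairing_def)

lemma pairing_diff: "pairing a (x - y) = pairing a x - pairing a y"
  by (simp add: pairing_def inner_diff_right right_diff_distrib diff_divide_distrib)

lemma pairing_minus: "pairing a (- x) = - pairing a x"
  by (simp add: pairing_def)

lemma pairing_minus_left: "pairing (- a) x = - pairing a x"
  by (simp add: pairing_def)

lemma pairing_sum: "pairing a (\<Sum>i\<in>I. f i) = (\<Sum>i\<in>I. pairing a (f i))"
  by (simp add: pairing_def inner_sum_right sum_distrib_left sum_divide_distrib)

lemma pairing_self: "a \<noteq> 0 \<Longrightarrow> pairing a a = 2"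
  by (simp add: pairing_def)

lemma pairing_gt_0_iff: "a \<noteq> 0 \<Longrightarrow> 0 < pairing a x \<longleftrightarrow> 0 < a \<bullet> x"
  by (auto simp: pairing_def zero_less_divide_iff not_less[THEN iffD2, OF inner_ge_zero])

lemma pairing_lt_0_iff: "a \<noteq> 0 \<Longrightarrow> pairing a x < 0 \<longleftrightarrow> a \<bullet> x < 0"
  by (auto simp: pairing_def divide_less_0_iff not_less[THEN iffD2, OF inner_ge_zero])

lemma refl_self: "refl a a = - a"
  by (cases "a = 0") (simp_all add: refl_def pairing_self scaleR_2)

lemma refl_minus_left: "refl (- a) = refl a"
  by (simp add: refl_def fun_eq_iff pairing_minus_left)

lemma refl_minus: "refl a (- x) = - refl a x"
  by (simp add: refl_def pairing_minus)

lemma refl_fixes: "a \<bullet> x = 0 \<Longrightarrow> refl a x = x"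
  by (simp add: refl_def pairing_def)

lemma orthogonal_transformation_refl: "orthogonal_transformation (refl a)"
proof (cases "a = 0")
  case False
  have "linear (refl a)"
    by (rule linearI)
      (simp_all add: refl_def pairing_add pairing_scaleR scaleR_add_left algebra_simps)
  moreover have "refl a x \<bullet> refl a y = x \<bullet> y" for x y
    using False
    by (simp add: refl_def pairing_def inner_diff_left inner_diff_right inner_commute field_simps)
  ultimately show ?thesis
    by (simp add: orthogonal_transformation_def)
qed (simp add: refl_def orthogonal_transformation_def linear_iff)

lemma inner_refl: "refl a x \<bullet> refl a y = x \<bullet> y"
  using orthogonal_transformation_refl by (auto simp: orthogonal_transformation_def)

lemma refl_refl: "refl a (refl a x) = x"
proof (cases "a = 0")
  case False
  then show ?thesis
    by (simp add: refl_def pairing_diff pairing_scaleR pairing_self algebra_simps flip: scaleR_left.add)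
qed (simp add: refl_def)

lemma refl_comp_refl: "refl a \<circ> refl a = id"
  by (simp add: fun_eq_iff refl_refl)

lemma inner_refl_left: "refl a x \<bullet> y = x \<bullet> refl a y"
  by (metis inner_refl refl_refl)

lemma pairing_orthogonal:
  assumes "orthogonal_transformation f"
  shows "pairing (f a) (f x) = pairing a x"
  using assms by (simp add: pairing_def orthogonal_transformation_def)

lemma refl_orthogonal:
  assumes "orthogonal_transformation f"
  shows "refl (f a) (f x) = f (refl a x)"
  using assms orthogonal_transformation_linear[OF assms]
  by (simp add: refl_def pairing_orthogonal linear_diff linear_cmul)

lemma pairing_refl: "pairing (refl a b) (refl a x) = pairing b x"
  by (rule pairing_orthogonal[OF orthogonal_transformation_refl])

lemma refl_conj: "refl (refl a b) (refl a x) = refl a (refl b x)"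
  by (rule refl_orthogonal[OF orthogonal_transformation_refl])

section \<open>Words in reflections\<close>

lemma word_Nil [simp]: "word r [] = id"
  by (simp add: word_def)

lemma word_Cons [simp]: "word r (a # as) = r a \<circ> word r as"
  by (simp add: word_def)

lemma word_append: "word r (as @ bs) = word r as \<circ> word r bs"
  by (induction as) (simp_all add: fun_eq_iff)

lemma orthogonal_transformation_word: "orthogonal_transformation (word refl as)"
proof (induction as)
  case (Cons a as)
  then show ?case
    unfolding word_Cons by (rule orthogonal_transformation_compose[OF orthogonal_transformation_refl])
qed (simp add: id_def)

lemma word_rev: "word refl (rev as) \<circ> word refl as = id"
proof (induction as)
  case (Cons a as)
  have "word refl (rev (a # as)) \<circ> word refl (a # as)
      = word refl (rev as) \<circ> (refl a \<circ> refl a) \<circ> word refl as"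
    by (simp add: word_append comp_assoc)
  also have "\<dots> = id"
    using Cons by (simp only: refl_comp_refl comp_id)
  finally show ?case .
qed simp

section \<open>Root systems with a basis\<close>

locale root_basis =
  fixes \<Phi> \<Delta> :: "'a::euclidean_space set"
  assumes irreducible: "irreducible_root_system \<Phi>"
    and simple: "simple_roots \<Phi> \<Delta>"
begin

abbreviation P :: "'a set" where "P \<equiv> pos_roots \<Phi> \<Delta>"

lemma finite_roots: "finite \<Phi>"
  and zero_notin_roots: "0 \<notin> \<Phi>"
  and span_roots: "span \<Phi> = UNIV"
  and refl_root: "a \<in> \<Phi> \<Longrightarrow> b \<in> \<Phi> \<Longrightarrow> refl a b \<in> \<Phi>"
  and pairing_Ints: "a \<in> \<Phi> \<Longrightarrow> b \<in> \<Phi> \<Longrightarrow> pairing a b \<in> \<int>"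
  and multiple_root: "a \<in> \<Phi> \<Longrightarrow> c *\<^sub>R a \<in> \<Phi> \<Longrightarrow> c = 1 \<or> c = -1"
  using irreducible unfolding irreducible_root_system_def by simp_all

lemma not_decomposable:
  assumes "A \<noteq> {}" "B \<noteq> {}" "A \<union> B = \<Phi>"
  shows "\<exists>a\<in>A. \<exists>b\<in>B. a \<bullet> b \<noteq> 0"
proof (rule ccontr)
  assume "\<not> ?thesis"
  then have "\<exists>A B. A \<noteq> {} \<and> B \<noteq> {} \<and> A \<union> B = \<Phi> \<and> (\<forall>\<alpha>\<in>A. \<forall>\<beta>\<in>B. \<alpha> \<bullet> \<beta> = 0)"
    using assms by (intro exI[of _ A] exI[of _ B]) simp
  then show False
    using irreducible by (simp add: irreducible_root_system_def)
qed

lemma basis_subset: "\<Delta> \<subseteq> \<Phi>"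
  and independent_basis: "independent \<Delta>"
  and root_cases: "b \<in> \<Phi> \<Longrightarrow> b \<in> P \<or> - b \<in> P"
  using simple unfolding simple_roots_def by blast+

lemma finite_basis: "finite \<Delta>"
  using basis_subset finite_roots by (rule finite_subset)

lemma root_nonzero: "a \<in> \<Phi> \<Longrightarrow> a \<noteq> 0"
  using zero_notin_roots by blast

lemma neg_root: "a \<in> \<Phi> \<Longrightarrow> - a \<in> \<Phi>"
  using refl_root[of a a] by (simp add: refl_self)

lemma neg_root_iff: "- a \<in> \<Phi> \<longleftrightarrow> a \<in> \<Phi>"
  using neg_root[of a] neg_root[of "- a"] by auto

lemma pos_subset: "P \<subseteq> \<Phi>"
  by (auto simp: pos_roots_def)

text \<open>The sum of the fundamental coweights, seen through the inner product:
  \<open>b \<bullet> v\<close> is the height of the root \<open>b\<close>, and \<open>v\<close> is a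
  regular dominant vector.\<close>

definition v :: 'a where
  "v = (SOME v. \<forall>a\<in>\<Delta>. a \<bullet> v = 1)"

text \<open>The simple roots are linearly independent, so a linear functional takes prescribed
  values on them; its adjoint at \<open>1\<close> represents it by the inner product.\<close>

lemma dual_vector: "\<exists>u. \<forall>a\<in>\<Delta>. a \<bullet> u = f a"
proof -
  obtain g where g: "linear g" "\<And>a. a \<in> \<Delta> \<Longrightarrow> g a = (f a :: real)"
    using linear_independent_extend[OF independent_basis, of f] by auto
  have "a \<bullet> adjoint g 1 = f a" if "a \<in> \<Delta>" for a
    using adjoint_works[OF g(1), of a 1] g(2)[OF that] by simp
  then show ?thesis
    by blast
qed

lemma basis_inner_v: "a \<in> \<Delta> \<Longrightarrow> a \<bullet> v = 1"
proof -
  have "\<forall>a\<in>\<Delta>. a \<bullet> v = 1"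
    unfolding v_def by (rule someI_ex, rule dual_vector)
  then show "a \<in> \<Delta> \<Longrightarrow> a \<bullet> v = 1"
    by blast
qed

lemma pos_root_ge_1:
  assumes "b \<in> P"
  shows "1 \<le> b \<bullet> v"
proof -
  obtain c :: "'a \<Rightarrow> nat" where c: "b = (\<Sum>a\<in>\<Delta>. real (c a) *\<^sub>R a)"
    using assms by (auto simp: pos_roots_def)
  have *: "b \<bullet> v = real (\<Sum>a\<in>\<Delta>. c a)"
    by (simp add: c inner_sum_left basis_inner_v)
  have "(\<Sum>a\<in>\<Delta>. c a) \<noteq> 0"
  proof
    assume "(\<Sum>a\<in>\<Delta>. c a) = 0"
    then have "b = 0"
      by (simp add: c finite_basis)
    with assms show False
      using pos_subset root_nonzero by blast
  qed
  with * show ?thesis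
    by linarith
qed

lemma pos_roots_eq: "P = {b \<in> \<Phi>. 0 < b \<bullet> v}"
proof -
  have "b \<in> P" if "b \<in> \<Phi>" "0 < b \<bullet> v" for b
    using root_cases[OF that(1)] pos_root_ge_1[of "- b"] that(2) by auto
  then show ?thesis
    using pos_root_ge_1 pos_subset by force
qed

lemma pos_root_iff: "b \<in> \<Phi> \<Longrightarrow> b \<in> P \<longleftrightarrow> 0 < b \<bullet> v"
  by (simp add: pos_roots_eq)

lemma inner_v_nonzero: "b \<in> \<Phi> \<Longrightarrow> b \<bullet> v \<noteq> 0"
  using root_cases[of b] pos_root_ge_1[of b] pos_root_ge_1[of "- b"] by auto

lemma neg_pos_iff: "b \<in> \<Phi> \<Longrightarrow> - b \<in> P \<longleftrightarrow> b \<notin> P"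
  using inner_v_nonzero[of b] by (auto simp: pos_roots_eq neg_root_iff)

lemma basis_pos: "\<Delta> \<subseteq> P"
  using basis_subset basis_inner_v by (auto simp: pos_roots_eq)

lemma nonneg_on_pos:
  assumes "b \<in> P" and "\<And>a. a \<in> \<Delta> \<Longrightarrow> 0 \<le> a \<bullet> x"
  shows "0 \<le> b \<bullet> x"
proof -
  obtain c :: "'a \<Rightarrow> nat" where c: "b = (\<Sum>a\<in>\<Delta>. real (c a) *\<^sub>R a)"
    using assms by (auto simp: pos_roots_def)
  then show ?thesis
    by (simp add: inner_sum_left sum_nonneg assms(2))
qed

text \<open>A positive root other than \<open>a\<close> is not a multiple of \<open>a\<close>, so
  another simple root occurs in it. As \<open>refl a\<close> changes only the coefficient of
  \<open>a\<close>, a positive coefficient survives and the image cannot be negative.\<close>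

lemma simple_refl_pos:
  assumes a: "a \<in> \<Delta>" and b: "b \<in> P" and "b \<noteq> a"
  shows "refl a b \<in> P"
proof -
  obtain c :: "'a \<Rightarrow> nat" where c: "b = (\<Sum>a\<in>\<Delta>. real (c a) *\<^sub>R a)"
    using b by (auto simp: pos_roots_def)
  have "\<exists>d\<in>\<Delta>. d \<noteq> a \<and> c d \<noteq> 0"
  proof (rule ccontr)
    assume "\<not> ?thesis"
    then have "b = (\<Sum>d\<in>{a}. real (c d) *\<^sub>R d)"
      unfolding c using a finite_basis by (intro sum.mono_neutral_right) auto
    then have ba: "b = real (c a) *\<^sub>R a"
      by simp
    then have "real (c a) = 1 \<or> real (c a) = -1"
      using b a pos_subset basis_subset multiple_root by blast
    with ba \<open>b \<noteq> a\<close> show False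
      by auto
  qed
  then obtain d where d: "d \<in> \<Delta>" "d \<noteq> a" "c d \<noteq> 0"
    by blast
  \<comment> \<open>Pairing with \<open>u\<close> reads off the coefficient of
    \<open>d\<close>.\<close>
  obtain u where u: "\<forall>e\<in>\<Delta>. e \<bullet> u = of_bool (e = d)"
    using dual_vector[of "\<lambda>e. of_bool (e = d)"] ..
  have "b \<bullet> u = (\<Sum>e\<in>\<Delta>. if e = d then real (c d) else 0)"
    unfolding c inner_sum_left by (intro sum.cong) (auto simp: u)
  also have "\<dots> > 0"
    using d finite_basis by simp
  finally have "0 < refl a b \<bullet> u"
    using u a d by (simp add: refl_def inner_diff_left)
  moreover have "refl a b \<in> \<Phi>"
    using a b basis_subset pos_subset refl_root by blast
  moreover have "0 \<le> - refl a b \<bullet> u" if "- refl a b \<in> P"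
    using nonneg_on_pos[OF that] u by simp
  ultimately show ?thesis
    using root_cases by force
qed

lemma simple_refl_pos_iff:
  assumes "a \<in> \<Delta>" "b \<in> \<Phi>" "b \<noteq> a" "b \<noteq> - a"
  shows "refl a b \<in> P \<longleftrightarrow> b \<in> P"
proof -
  have "refl a b \<in> \<Phi>"
    using assms basis_subset refl_root by blast
  moreover have "refl a (- b) \<in> P" if "b \<notin> P"
    using assms neg_pos_iff that by (intro simple_refl_pos) auto
  ultimately show ?thesis
    using assms simple_refl_pos neg_pos_iff[of "refl a b"] by (auto simp: refl_minus)
qed

text \<open>Otherwise \<open>b\<close>, a nonnegative combination of simple roots, would satisfy
  \<open>b \<bullet> b \<le> 0\<close>.\<close>

lemma exists_simple_inner_pos:
  assumes "b \<in> P"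
  obtains a where "a \<in> \<Delta>" "0 < a \<bullet> b"
proof (rule ccontr)
  assume "\<not> thesis"
  then have "\<And>a. a \<in> \<Delta> \<Longrightarrow> 0 \<le> a \<bullet> (- b)"
    using that by force
  then have "0 \<le> b \<bullet> (- b)"
    by (rule nonneg_on_pos[OF assms])
  moreover have "0 < b \<bullet> b"
    using assms pos_subset root_nonzero by auto
  ultimately show False
    by simp
qed

lemma pairing_ge_1:
  assumes "a \<in> \<Phi>" "b \<in> \<Phi>" "0 < pairing a b"
  shows "1 \<le> pairing a b"
proof -
  obtain k where "pairing a b = of_int k"
    using pairing_Ints[OF assms(1,2)] by (elim Ints_cases)
  with assms(3) show ?thesis
    by auto
qed

text \<open>Descent on the height \<open>b \<bullet> v\<close>, which drops by \<open>pairing a b \<ge> 1\<close>.\<close>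

lemma pos_root_induct [consumes 1, case_names basis step]:
  assumes "b \<in> P"
    and basis: "\<And>a. a \<in> \<Delta> \<Longrightarrow> Q a"
    and step: "\<And>a b. a \<in> \<Delta> \<Longrightarrow> b \<in> P \<Longrightarrow> 0 < a \<bullet> b \<Longrightarrow> refl a b \<in> P \<Longrightarrow> Q (refl a b) \<Longrightarrow> Q b"
  shows "Q b"
proof -
  have "Q b" if "b \<in> P" "b \<bullet> v < real n" for n b
    using that
  proof (induction n arbitrary: b)
    case 0
    then show ?case
      using pos_root_ge_1[of b] by simp
  next
    case (Suc n)
    obtain a where a: "a \<in> \<Delta>" "0 < a \<bullet> b"
      using exists_simple_inner_pos[OF Suc.prems(1)] .
    have "a \<in> \<Phi>" "b \<in> \<Phi>"
      using a basis_subset pos_subset Suc.prems by auto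
    show ?case
    proof (cases "b \<in> \<Delta>")
      case False
      then have r: "refl a b \<in> P"
        using a Suc.prems simple_refl_pos by blast
      have "1 \<le> pairing a b"
        using \<open>a \<in> \<Phi>\<close> \<open>b \<in> \<Phi>\<close> a by (intro pairing_ge_1) (simp_all add: pairing_gt_0_iff root_nonzero)
      then have "refl a b \<bullet> v < real n"
        using Suc.prems(2) a by (simp add: refl_def inner_diff_left basis_inner_v)
      then show ?thesis
        using step a Suc.prems(1) r Suc.IH by blast
    qed (rule basis)
  qed
  then show ?thesis
    using assms(1) reals_Archimedean2 by blast
qed

end

section \<open>Affine reflections on level-zero weights\<close>

lemma fst_af_refl: "fst (af_refl s x) = refl (fst s) (fst x)"
  by (simp add: af_refl_def af_pairing_def cl_def refl_def)

lemma snd_af_refl: "snd (af_refl s x) = snd x - pairing (fst s) (fst x) * snd s"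
  by (simp add: af_refl_def af_pairing_def cl_def)

lemma af_pairing_fst: "af_pairing s x = pairing (fst s) (fst x)"
  by (simp add: af_pairing_def cl_def)

lemma af_pairing_af_refl: "af_pairing (af_refl s b) (af_refl s x) = af_pairing b x"
  by (simp add: af_pairing_fst fst_af_refl pairing_refl)

lemma af_pairing_af_refl_self: "fst s \<noteq> 0 \<Longrightarrow> af_pairing s (af_refl s x) = - af_pairing s x"
  by (simp add: af_pairing_fst fst_af_refl refl_def pairing_diff pairing_scaleR pairing_self)

lemma af_refl_fixes: "af_pairing s x = 0 \<Longrightarrow> af_refl s x = x"
  by (simp add: af_refl_def)

lemma af_refl_diff: "af_refl s (x - c *\<^sub>R b) = af_refl s x - c *\<^sub>R af_refl s b"
  by (simp add: af_refl_def af_pairing_fst pairing_diff pairing_scaleR algebra_simps)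

lemma af_refl_conj: "af_refl (af_refl s b) (af_refl s x) = af_refl s (af_refl b x)"
proof -
  have "af_refl (af_refl s b) (af_refl s x) = af_refl s x - af_pairing b x *\<^sub>R af_refl s b"
    unfolding af_refl_def[of "af_refl s b"] af_pairing_af_refl ..
  also have "\<dots> = af_refl s (af_refl b x)"
    unfolding af_refl_def[of b] af_refl_diff ..
  finally show ?thesis .
qed

lemma af_refl_af_refl: "af_refl s (af_refl s x) = x"
proof (cases "fst s = 0")
  case False
  then have "af_pairing s (af_refl s x) = - af_pairing s x"
    by (rule af_pairing_af_refl_self)
  then have "af_refl s (af_refl s x) = af_refl s x + af_pairing s x *\<^sub>R s"
    unfolding af_refl_def[of s "af_refl s x"] by simp
  then show ?thesis
    by (simp add: af_refl_def)
qed (simp add: af_refl_def af_pairing_fst pairing_def)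

section \<open>Differences of semi-infinite length\<close>

context root_basis
begin

text \<open>\<open>T x \<beta>\<close> is the change in semi-infinite length along \<open>\<mu> < r\<^sub>\<beta> \<mu>\<close> when \<open>cl \<mu> = x\<close>.\<close>

definition L :: "'a \<Rightarrow> real" where
  "L x = (\<Sum>z | z \<in> \<Phi> \<and> z \<bullet> x < 0. of_bool (z \<in> P))"

definition R :: "'a \<Rightarrow> 'a" where
  "R x = (\<Sum>z | z \<in> \<Phi> \<and> z \<bullet> x < 0. z)"

definition T :: "'a \<Rightarrow> 'a \<times> real \<Rightarrow> real" where
  "T x b = L (refl (fst b) x) - L x - snd b * pairing (fst b) (R x)"

text \<open>\<open>refl a\<close> carries the roots negative on \<open>x\<close> to those negative
  on \<open>refl a x\<close>. Since \<open>L\<close> and \<open>R\<close> are sums over these sets,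
  both transform by reindexing.\<close>

lemma sum_neg_refl:
  assumes "a \<in> \<Phi>"
  shows "(\<Sum>z | z \<in> \<Phi> \<and> z \<bullet> refl a x < 0. f z) = (\<Sum>z | z \<in> \<Phi> \<and> z \<bullet> x < 0. f (refl a z))"
  by (rule sum.reindex_bij_witness[of _ "refl a" "refl a"])
    (auto simp: refl_refl refl_root[OF assms] inner_refl inner_refl_left)

lemma L_refl:
  "a \<in> \<Phi> \<Longrightarrow> L (refl a x) = (\<Sum>z | z \<in> \<Phi> \<and> z \<bullet> x < 0. of_bool (refl a z \<in> P))"
  unfolding L_def by (rule sum_neg_refl)

lemma R_refl: "a \<in> \<Phi> \<Longrightarrow> R (refl a x) = refl a (R x)"
  unfolding R_def
  by (simp add: sum_neg_refl linear_sum[OF orthogonal_transformation_linear[OF orthogonal_transformation_refl]])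

text \<open>\<open>T\<close> is a difference of semi-infinite lengths. Going from
  \<open>r\<^sub>s \<mu>\<close> to \<open>r\<^sub>s r\<^sub>\<beta> \<mu>\<close> by way of
  \<open>\<mu>\<close> and \<open>r\<^sub>\<beta> \<mu>\<close> gives three differences, which add
  up.\<close>

lemma T_cocycle:
  assumes "fst s \<in> \<Phi>" "fst b \<in> \<Phi>"
  shows "T (refl (fst s) x) (af_refl s b) = T x b + T (refl (fst b) x) s - T x s"
  using assms
  by (simp add: T_def fst_af_refl snd_af_refl refl_conj R_refl pairing_refl)
    (simp add: refl_def pairing_diff pairing_scaleR algebra_simps)

lemma T_refl_self:
  assumes "fst s \<in> \<Phi>"
  shows "T (refl (fst s) x) s = - T x s"
  using assms root_nonzero[OF assms]
  by (simp add: T_def R_refl refl_refl)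
    (simp add: refl_def pairing_diff pairing_scaleR pairing_self algebra_simps)

text \<open>Split \<open>T\<close> into contributions of the roots negative on \<open>x\<close>. By
  \<open>chi\<close> they vanish away from \<plusminus> \<open>fst s\<close>. If the pairing is
  positive, only \<open>- fst s\<close> remains, and it contributes \<open>1\<close> by
  \<open>self\<close>; antisymmetry gives the other signs.\<close>

lemma T_simple:
  assumes s: "fst s \<in> \<Phi>"
    and chi: "\<And>z. z \<in> \<Phi> \<Longrightarrow> z \<noteq> fst s \<Longrightarrow> z \<noteq> - fst s \<Longrightarrow>
      of_bool (refl (fst s) z \<in> P) = of_bool (z \<in> P) + snd s * pairing (fst s) z"
    and self: "of_bool (fst s \<in> P) + snd s = 1"
  shows "T x s = sgn (pairing (fst s) x)"
proof -
  let ?a = "fst s"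
  have nz: "?a \<noteq> 0"
    using s by (rule root_nonzero)
  have one: "T y s = 1" if y: "0 < pairing ?a y" for y
  proof -
    let ?g = "\<lambda>z. of_bool (refl ?a z \<in> P) - of_bool (z \<in> P) - snd s * pairing ?a z"
    have ay: "0 < ?a \<bullet> y"
      using y nz by (simp add: pairing_gt_0_iff)
    have "T y s = (\<Sum>z | z \<in> \<Phi> \<and> z \<bullet> y < 0. ?g z)"
      unfolding T_def L_refl[OF s] by (simp add: L_def R_def pairing_sum sum_subtractf sum_distrib_left)
    also have "\<dots> = (\<Sum>z\<in>{- ?a}. ?g z)"
    proof (rule sum.mono_neutral_right)
      show "\<forall>z\<in>{z \<in> \<Phi>. z \<bullet> y < 0} - {- ?a}. ?g z = 0"
        using chi ay by force
    qed (use finite_roots s neg_root ay in auto)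
    also have "\<dots> = 1"
      using self neg_pos_iff[OF s] nz
      by (simp add: refl_minus refl_self pairing_minus pairing_self of_bool_def split: if_splits)
    finally show ?thesis .
  qed
  \<comment> \<open>A negative pairing at \<open>x\<close> is recorded as a positive one at
    \<open>refl ?a x\<close>, where \<open>one\<close> applies.\<close>
  consider "0 < pairing ?a x" | "pairing ?a x = 0" | "0 < pairing ?a (refl ?a x)"
    using nz by (force simp: refl_def pairing_diff pairing_scaleR pairing_self)
  then show ?thesis
  proof cases
    case 2
    then have "refl ?a x = x"
      by (simp add: refl_def)
    with T_refl_self[OF s, of x] 2 show ?thesis
      by simp
  next
    case 3
    then have "pairing ?a x < 0"
      using nz by (simp add: refl_def pairing_diff pairing_scaleR pairing_self)
    with T_refl_self[OF s, of x] one[OF 3] show ?thesis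
      by simp
  qed (simp add: one)
qed

text \<open>Pairing both sides with \<open>x\<close> turns this into a strict inequality between sums over \<open>\<Phi>\<close>.\<close>

lemma pairing_R_neg:
  assumes a: "a \<in> \<Phi>" and pos: "0 < pairing a x"
  shows "pairing a (R x) < 0"
proof -
  let ?y = "refl a x"
  have ax: "0 < a \<bullet> x"
    using pos a root_nonzero by (simp add: pairing_gt_0_iff)
  have sum: "R y \<bullet> x = (\<Sum>z\<in>\<Phi>. if z \<bullet> y < 0 then z \<bullet> x else 0)" for y
    unfolding R_def inner_sum_left using finite_roots by (rule sum.inter_filter)
  have "R x \<bullet> x < R ?y \<bullet> x"
    unfolding sum
  proof (rule sum_strict_mono_ex1[OF finite_roots])
    have "a \<bullet> ?y < 0"
      using ax by (simp add: refl_self flip: inner_refl_left)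
    then show "\<exists>z\<in>\<Phi>. (if z \<bullet> x < 0 then z \<bullet> x else 0) < (if z \<bullet> ?y < 0 then z \<bullet> x else 0)"
      using ax a by (intro bexI[of _ a]) auto
  qed auto
  also have "R ?y \<bullet> x = R x \<bullet> x - pairing a (R x) * (a \<bullet> x)"
    unfolding R_refl[OF a] by (simp add: refl_def inner_diff_left)
  finally show ?thesis
    using ax by (simp add: mult_less_0_iff)
qed

end

section \<open>The order generated by positive affine reflections\<close>

text \<open>
  \<open>z + n\<delta>\<close> is a positive affine root iff \<open>n \<ge> 1 - [z \<in> P]\<close>. \<open>S_shift\<close> says that \<open>r\<^sub>s\<close> respects this threshold
  away from \<open>\<plusminus> fst s\<close>, and \<open>S_self\<close> that \<open>s\<close> sits on it. The axioms also hold for the finite system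
  embedded by \<open>fin\<close>.
\<close>

locale affine_basis = root_basis +
  fixes Pos S :: "('a \<times> real) set" and F :: "'a \<times> real \<Rightarrow> real"
  assumes Pos_root: "b \<in> Pos \<Longrightarrow> fst b \<in> \<Phi>"
    and S_subset: "S \<subseteq> Pos"
    and S_refl: "s \<in> S \<Longrightarrow> b \<in> Pos \<Longrightarrow> b \<noteq> s \<Longrightarrow> af_refl s b \<in> Pos"
    and S_shift: "s \<in> S \<Longrightarrow> z \<in> \<Phi> \<Longrightarrow> z \<noteq> fst s \<Longrightarrow> z \<noteq> - fst s \<Longrightarrow>
      of_bool (refl (fst s) z \<in> P) = of_bool (z \<in> P) + snd s * pairing (fst s) z"
    and S_self: "s \<in> S \<Longrightarrow> of_bool (fst s \<in> P) + snd s = 1"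
    and S_descent: "b \<in> Pos \<Longrightarrow> b \<notin> S \<Longrightarrow> \<exists>s\<in>S. 0 < af_pairing s b"
    and linear_F: "linear F"
    and F_ge_1: "b \<in> Pos \<Longrightarrow> 1 \<le> F b"
begin

definition step :: "'a \<times> real \<Rightarrow> 'a \<times> real \<Rightarrow> bool" where
  "step x y \<longleftrightarrow> (\<exists>b\<in>Pos. 0 < af_pairing b x \<and> y = af_refl b x)"

lemma stepE:
  assumes "step x y"
  obtains b where "b \<in> Pos" "0 < af_pairing b x" "y = af_refl b x"
  using assms unfolding step_def by blast

abbreviation lt where "lt \<equiv> step\<^sup>+\<^sup>+"
abbreviation le where "le \<equiv> step\<^sup>*\<^sup>*"

lemma S_root: "s \<in> S \<Longrightarrow> fst s \<in> \<Phi>"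
  using S_subset Pos_root by blast

lemma S_nonzero: "s \<in> S \<Longrightarrow> fst s \<noteq> 0"
  using S_root root_nonzero by blast

lemma T_S: "s \<in> S \<Longrightarrow> T x s = sgn (pairing (fst s) x)"
  using T_simple S_root S_shift S_self by blast

lemma F_af_refl: "F (af_refl s x) = F x - af_pairing s x * F s"
  by (simp add: af_refl_def linear_diff[OF linear_F] linear_cmul[OF linear_F])

lemma step_F: "step x y \<Longrightarrow> F y < F x"
  using F_ge_1 by (fastforce simp: step_def F_af_refl)

text \<open>Each step subtracts a positive multiple of a root on which \<open>F\<close> is at least
  \<open>1\<close>. This is what makes the generated relation acyclic.\<close>

lemma lt_F: "lt x y \<Longrightarrow> F y < F x"
proof (induction rule: tranclp_induct)
  case (step y z)
  with step_F[of y z] show ?case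
    by simp
qed (rule step_F)

lemma lt_irrefl: "\<not> lt x x"
  using lt_F by blast

lemma lt_asym: "lt x y \<Longrightarrow> \<not> lt y x"
  using lt_F[of x y] lt_F[of y x] by auto

lemma le_iff: "le x y \<longleftrightarrow> x = y \<or> lt x y"
  by (auto dest: rtranclpD)

lemma step_S: "s \<in> S \<Longrightarrow> 0 < af_pairing s x \<Longrightarrow> step x (af_refl s x)"
  using S_subset by (auto simp: step_def)

lemma step_S': "s \<in> S \<Longrightarrow> af_pairing s x < 0 \<Longrightarrow> step (af_refl s x) x"
  using step_S[of s "af_refl s x"] by (simp add: af_pairing_af_refl_self S_nonzero af_refl_af_refl)

lemma le_S: "s \<in> S \<Longrightarrow> 0 \<le> af_pairing s x \<Longrightarrow> le x (af_refl s x)"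
  using step_S[of s x] af_refl_fixes[of s x] by (cases "af_pairing s x = 0") auto

lemma le_S': "s \<in> S \<Longrightarrow> af_pairing s x \<le> 0 \<Longrightarrow> le (af_refl s x) x"
  using step_S'[of s x] af_refl_fixes[of s x] by (cases "af_pairing s x = 0") auto

lemma step_af_refl:
  assumes "s \<in> S" "b \<in> Pos" "b \<noteq> s" "0 < af_pairing b x"
  shows "step (af_refl s x) (af_refl s (af_refl b x))"
  unfolding step_def
  using assms S_refl
  by (intro bexI[of _ "af_refl s b"]) (simp_all add: af_pairing_af_refl af_refl_conj)

section \<open>Lifting property, and covers under a simple reflection\<close>

definition lo :: "'a \<times> real \<Rightarrow> 'a \<times> real \<Rightarrow> 'a \<times> real" where
  "lo s x = (if af_pairing s x < 0 then af_refl s x else x)"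

definition hi :: "'a \<times> real \<Rightarrow> 'a \<times> real \<Rightarrow> 'a \<times> real" where
  "hi s x = (if 0 < af_pairing s x then af_refl s x else x)"

text \<open>\<open>lo\<close> and \<open>hi\<close> pick the lower and the upper one of
  \<open>x\<close> and \<open>af_refl s x\<close>. A step along \<open>s\<close> leaves both ends
  unchanged. Any other step is carried by \<open>af_refl s\<close> to a step, and one of the two
  steps, with the comparison of a point and its mirror image, settles each sign pattern.\<close>

lemma lo_hi_step:
  assumes s: "s \<in> S" and "step x y"
  shows "le (lo s x) (lo s y) \<and> le (hi s x) (hi s y)"
proof -
  obtain b where b: "b \<in> Pos" "0 < af_pairing b x" "y = af_refl b x"
    using assms by (auto simp: step_def)
  show ?thesis
  proof (cases "b = s")
    case True
    then have "af_pairing s y < 0"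
      using b s by (simp add: af_pairing_af_refl_self S_nonzero)
    with True b show ?thesis
      by (simp add: lo_def hi_def af_refl_af_refl)
  next
    case False
    have r: "step (af_refl s x) (af_refl s y)"
      using step_af_refl[OF s b(1) False b(2)] b(3) by simp
    have "le (lo s x) (lo s y)"
      using r \<open>step x y\<close> le_S[OF s, of x] le_S'[OF s, of x]
      unfolding lo_def
      by (auto simp: not_less intro: rtranclp.rtrancl_into_rtrancl)
    moreover have "le (hi s x) (hi s y)"
      using r \<open>step x y\<close> le_S[OF s, of y] le_S'[OF s, of y]
      unfolding hi_def
      by (auto simp: not_less intro: converse_rtranclp_into_rtranclp)
    ultimately show ?thesis ..
  qed
qed

lemma lo_mono:
  assumes "s \<in> S" "le x y"
  shows "le (lo s x) (lo s y)"
  using assms(2)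
proof (induction rule: rtranclp_induct)
  case (step y z)
  then show ?case
    using lo_hi_step[OF assms(1) step.hyps(2)] rtranclp_trans by metis
qed simp

lemma hi_mono:
  assumes "s \<in> S" "le x y"
  shows "le (hi s x) (hi s y)"
  using assms(2)
proof (induction rule: rtranclp_induct)
  case (step y z)
  then show ?case
    using lo_hi_step[OF assms(1) step.hyps(2)] rtranclp_trans by metis
qed simp

text \<open>By monotonicity \<open>lo s z\<close> is squeezed between \<open>x\<close> and
  \<open>x\<close> for an intermediate \<open>z\<close>, so \<open>z\<close> is one of the two
  ends.\<close>

lemma covers_simple:
  assumes s: "s \<in> S" and pos: "0 < af_pairing s x"
  shows "covers lt x (af_refl s x)"
proof -
  have "False" if xz: "lt x z" and zy: "lt z (af_refl s x)" for z
  proof -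
    have neg: "af_pairing s (af_refl s x) < 0"
      using pos s by (simp add: af_pairing_af_refl_self S_nonzero)
    have "le (lo s x) (lo s z)" "le (lo s z) (lo s (af_refl s x))"
      by (rule lo_mono[OF s tranclp_into_rtranclp[OF xz]] lo_mono[OF s tranclp_into_rtranclp[OF zy]])+
    then have "le x (lo s z)" "le (lo s z) x"
      using pos neg by (auto simp: lo_def af_refl_af_refl)
    then have "lo s z = x"
      using lt_asym unfolding le_iff by blast
    then have "z = x \<or> z = af_refl s x"
      by (auto simp: lo_def af_refl_af_refl split: if_splits)
    with xz zy show False
      using lt_irrefl by blast
  qed
  with step_S[OF assms] show ?thesis
    by (auto simp: covers_def)
qed

text \<open>In the chain from \<open>x\<close> through \<open>af_refl s x\<close> and
  \<open>af_refl s y\<close> to \<open>y = af_refl b x\<close>, the middle link is strict and one of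
  the outer links is strict too, so an inner point lies strictly between the ends.\<close>

lemma not_covers_if_signs_change:
  assumes s: "s \<in> S" and b: "b \<in> Pos" "b \<noteq> s" "0 < af_pairing b x"
    and sx: "0 \<le> af_pairing s x" and sy: "af_pairing s (af_refl b x) \<le> 0"
    and "af_pairing s x \<noteq> 0 \<or> af_pairing s (af_refl b x) \<noteq> 0"
  shows "\<not> covers lt x (af_refl b x)"
proof -
  let ?y = "af_refl b x"
  have r: "lt (af_refl s x) (af_refl s ?y)"
    using step_af_refl[OF s b] by blast
  have "le x (af_refl s x)" "le (af_refl s ?y) ?y"
    using le_S[OF s sx] le_S'[OF s sy] .
  consider "0 < af_pairing s x" | "af_pairing s ?y < 0"
    using assms by linarith
  then show ?thesis
  proof cases
    case 1
    then have "lt x (af_refl s x)" "lt (af_refl s x) ?y"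
      using step_S[OF s 1] tranclp_rtranclp_tranclp[OF r \<open>le (af_refl s ?y) ?y\<close>] by blast+
    then show ?thesis
      unfolding covers_def by blast
  next
    case 2
    then have "lt x (af_refl s ?y)" "lt (af_refl s ?y) ?y"
      using step_S'[OF s 2] rtranclp_tranclp_tranclp[OF \<open>le x (af_refl s x)\<close> r] by blast+
    then show ?thesis
      unfolding covers_def by blast
  qed
qed

text \<open>\<open>lo s z\<close> lies weakly between the reflected ends and cannot equal the lower
  one. If it equals the upper one, then \<open>z = af_refl s y\<close>, and \<open>x\<close> itself
  lies in between.\<close>

lemma between_af_refl_neg:
  assumes s: "s \<in> S" and sx: "af_pairing s x < 0" and sy: "af_pairing s y < 0"
    and xz: "lt x z" and zy: "lt z y"
  shows "\<exists>z'. lt (af_refl s x) z' \<and> lt z' (af_refl s y)"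
proof -
  have x: "lt (af_refl s x) x"
    using step_S'[OF s sx] by blast
  have "le (lo s x) (lo s z)" "le (lo s z) (lo s y)"
    by (rule lo_mono[OF s tranclp_into_rtranclp[OF xz]] lo_mono[OF s tranclp_into_rtranclp[OF zy]])+
  then have le: "le (af_refl s x) (lo s z)" "le (lo s z) (af_refl s y)"
    using sx sy by (auto simp: lo_def)
  have lo: "lo s z = z \<or> z = af_refl s (lo s z)"
    by (simp add: lo_def af_refl_af_refl)
  have "lo s z \<noteq> af_refl s x"
    using lo xz x lt_irrefl lt_asym by (metis af_refl_af_refl)
  then have 1: "lt (af_refl s x) (lo s z)"
    using le by (auto simp: le_iff)
  show ?thesis
  proof (cases "lo s z = af_refl s y")
    case True
    then have "z = af_refl s y"
      using lo zy lt_irrefl by (metis af_refl_af_refl)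
    with x xz show ?thesis
      by blast
  next
    case False
    with 1 le show ?thesis
      unfolding le_iff by metis
  qed
qed

text \<open>Dual to the previous case, with \<open>hi\<close>: now \<open>hi s z\<close> may
  collapse to \<open>af_refl s x\<close>, and then \<open>y\<close> lies in between.\<close>

lemma between_af_refl_pos:
  assumes s: "s \<in> S" and sx: "0 < af_pairing s x" and sy: "0 < af_pairing s y"
    and xz: "lt x z" and zy: "lt z y"
  shows "\<exists>z'. lt (af_refl s x) z' \<and> lt z' (af_refl s y)"
proof -
  have y: "lt y (af_refl s y)"
    using step_S[OF s sy] by blast
  have "le (hi s x) (hi s z)" "le (hi s z) (hi s y)"
    by (rule hi_mono[OF s tranclp_into_rtranclp[OF xz]] hi_mono[OF s tranclp_into_rtranclp[OF zy]])+
  then have le: "le (af_refl s x) (hi s z)" "le (hi s z) (af_refl s y)"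
    using sx sy by (auto simp: hi_def)
  have hi: "hi s z = z \<or> z = af_refl s (hi s z)"
    by (simp add: hi_def af_refl_af_refl)
  have "hi s z \<noteq> af_refl s y"
    using hi zy y lt_irrefl lt_asym by (metis af_refl_af_refl)
  then have 1: "lt (hi s z) (af_refl s y)"
    using le by (auto simp: le_iff)
  show ?thesis
  proof (cases "hi s z = af_refl s x")
    case True
    then have "z = af_refl s x"
      using hi xz lt_irrefl by (metis af_refl_af_refl)
    with y zy show ?thesis
      by blast
  next
    case False
    with 1 le show ?thesis
      unfolding le_iff by metis
  qed
qed

text \<open>\<open>af_refl s\<close> is an involution that exchanges the two sign cases, so
  intermediate elements can be carried in both directions.\<close>

lemma covers_af_refl_iff:
  assumes s: "s \<in> S" and b: "b \<in> Pos" "b \<noteq> s" "0 < af_pairing b x" and y: "y = af_refl b x"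
    and sgn: "0 < af_pairing s x \<and> 0 < af_pairing s y \<or> af_pairing s x < 0 \<and> af_pairing s y < 0"
  shows "covers lt (af_refl s x) (af_refl s y) \<longleftrightarrow> covers lt x y"
proof -
  have "step x y"
    using b y unfolding step_def by blast
  then have "lt x y" ..
  moreover have "lt (af_refl s x) (af_refl s y)"
    using step_af_refl[OF s b] y by blast
  moreover have "(\<exists>z. lt (af_refl s x) z \<and> lt z (af_refl s y)) \<longleftrightarrow> (\<exists>z. lt x z \<and> lt z y)"
    using sgn between_af_refl_pos[OF s, of x y] between_af_refl_neg[OF s, of x y]
      between_af_refl_pos[OF s, of "af_refl s x" "af_refl s y"]
      between_af_refl_neg[OF s, of "af_refl s x" "af_refl s y"]
    by (auto simp: af_pairing_af_refl_self S_nonzero[OF s] af_refl_af_refl)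
  ultimately show ?thesis
    by (simp add: covers_def)
qed

text \<open>Each descent lowers \<open>F\<close> by at least \<open>1\<close>: the pairing is a
  positive integer and \<open>F s \<ge> 1\<close>. Hence induction on a natural number bounding
  \<open>F\<close> suffices.\<close>

lemma Pos_induct [consumes 1, case_names simple descent]:
  assumes "b \<in> Pos"
    and simple: "\<And>s. s \<in> S \<Longrightarrow> Q s"
    and descent: "\<And>s b. s \<in> S \<Longrightarrow> b \<in> Pos \<Longrightarrow> b \<noteq> s \<Longrightarrow> 0 < af_pairing s b \<Longrightarrow>
      af_refl s b \<in> Pos \<Longrightarrow> Q (af_refl s b) \<Longrightarrow> Q b"
  shows "Q b"
proof -
  have "Q b" if "b \<in> Pos" "F b < real n" for n b
    using that
  proof (induction n arbitrary: b)
    case 0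
    then show ?case
      using F_ge_1[of b] by simp
  next
    case (Suc n)
    show ?case
    proof (cases "b \<in> S")
      case False
      then obtain s where s: "s \<in> S" "0 < af_pairing s b"
        using S_descent Suc.prems by blast
      have "1 \<le> af_pairing s b"
        using pairing_ge_1 S_root[OF s(1)] Pos_root[OF Suc.prems(1)] s(2) by (simp add: af_pairing_fst)
      moreover have "1 \<le> F s"
        using s S_subset F_ge_1 by blast
      ultimately have "1 \<le> af_pairing s b * F s"
        using mult_mono[of 1 "af_pairing s b" 1 "F s"] by simp
      then have "F (af_refl s b) < real n"
        using Suc.prems by (simp add: F_af_refl)
      moreover have "b \<noteq> s"
        using False s by blast
      ultimately show ?thesis
        using s Suc.prems Suc.IH S_refl descent by blast
    qed (rule simple)
  qed
  then show ?thesis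
    using assms(1) reals_Archimedean2 by blast
qed

lemma pairing_drop:
  assumes "0 < af_pairing b x" "0 < af_pairing s b"
  shows "af_pairing s (af_refl b x) < af_pairing s x"
  using assms by (simp add: af_refl_def af_pairing_fst pairing_diff pairing_scaleR)

lemma T_descent:
  assumes "s \<in> S" "b \<in> Pos"
  shows "T (fst (af_refl s x)) (af_refl s b)
    = T (fst x) b + sgn (af_pairing s (af_refl b x)) - sgn (af_pairing s x)"
  using assms by (simp add: fst_af_refl T_cocycle S_root Pos_root T_S af_pairing_fst)

theorem T_and_covers:
  assumes "b \<in> Pos" and "0 < af_pairing b x"
  shows "1 \<le> T (fst x) b \<and> (covers lt x (af_refl b x) \<longleftrightarrow> T (fst x) b = 1)"
  using assms
proof (induction b arbitrary: x rule: Pos_induct)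
  case (simple s)
  then show ?case
    using covers_simple by (simp add: T_S af_pairing_fst)
next
  case (descent s b)
  let ?y = "af_refl b x"
  let ?p = "af_pairing s x" and ?q = "af_pairing s ?y"
  have IH: "1 \<le> T (fst (af_refl s x)) (af_refl s b) \<and>
      (covers lt (af_refl s x) (af_refl s ?y) \<longleftrightarrow> T (fst (af_refl s x)) (af_refl s b) = 1)"
    using descent.IH[of "af_refl s x"] descent.prems by (simp add: af_pairing_af_refl af_refl_conj)
  have T: "T (fst (af_refl s x)) (af_refl s b) = T (fst x) b + sgn ?q - sgn ?p"
    using descent by (intro T_descent)
  have "?q < ?p"
    using descent by (intro pairing_drop)
  \<comment> \<open>As the pairing with \<open>s\<close> strictly drops from \<open>x\<close> to
    \<open>?y\<close>, it either keeps a nonzero sign or passes from nonnegative to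
    nonpositive.\<close>
  then consider "0 < ?p \<and> 0 < ?q \<or> ?p < 0 \<and> ?q < 0" | "0 \<le> ?p" "?q \<le> 0" "?p \<noteq> 0 \<or> ?q \<noteq> 0"
    by linarith
  then show ?case
  proof cases
    case 1
    then have "sgn ?q = sgn ?p"
      by auto
    with 1 IH T covers_af_refl_iff[OF descent.hyps(1-3) descent.prems refl 1] show ?thesis
      by simp
  next
    case 2
    \<comment> \<open>Here \<open>T\<close> at the reflected root is smaller by at least
      \<open>1\<close>, so \<open>T (fst x) b\<close> is at least \<open>2\<close>, and both sides
      of the equivalence are false.\<close>
    then have "sgn ?q + 1 \<le> sgn ?p"
      using \<open>?q < ?p\<close> by (auto simp: sgn_if)
    with IH T have "2 \<le> T (fst x) b"
      by linarith
    with not_covers_if_signs_change[OF descent.hyps(1-3) descent.prems 2] show ?thesis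
      by auto
  qed
qed

text \<open>This moves from the possibly singular point \<open>w lam\<close> to the regular point
  \<open>w v\<close>. The value \<open>1\<close> excludes sign changes during the descent, so all
  pairings that steer it are nonzero at \<open>x\<close> and keep their signs at
  \<open>x'\<close>.\<close>

lemma T_eq_1_transfer:
  assumes "b \<in> Pos" "0 < pairing (fst b) x" "T x b = 1"
    and "\<And>z. z \<in> \<Phi> \<Longrightarrow> 0 < z \<bullet> x \<Longrightarrow> 0 < z \<bullet> x'"
  shows "T x' b = 1"
  using assms
proof (induction b arbitrary: x x' rule: Pos_induct)
  case (simple s)
  then have "0 < pairing (fst s) x'"
    using S_root[of s] root_nonzero by (auto simp: pairing_gt_0_iff)
  with simple show ?case
    by (simp add: T_S)
next
  case (descent s b)
  let ?s = "refl (fst s)" and ?r = "refl (fst b)"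
  let ?y = "?r x" and ?y' = "?r x'"
  let ?p = "pairing (fst s) x" and ?q = "pairing (fst s) ?y"
  let ?p' = "pairing (fst s) x'" and ?q' = "pairing (fst s) ?y'"
  have roots: "fst s \<in> \<Phi>" "fst b \<in> \<Phi>"
    using S_root Pos_root descent by auto
  have T: "T (?s z) (af_refl s b) = T z b + sgn (pairing (fst s) (?r z)) - sgn (pairing (fst s) z)" for z
    using T_descent[OF descent.hyps(1,2), of "(z, 0)"] by (simp add: af_pairing_fst fst_af_refl)
  \<comment> \<open>The lower bound at the reflected root forces \<open>sgn ?p \<le> sgn ?q\<close>;
    together with \<open>?q < ?p\<close> this leaves only equal nonzero signs.\<close>
  have "1 \<le> T (?s x) (af_refl s b)"
    using T_and_covers[OF descent.hyps(5), of "af_refl s (x, 0)"] descent.prems(1)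
    by (simp add: af_pairing_af_refl) (simp add: af_pairing_fst fst_af_refl)
  then have "sgn ?p \<le> sgn ?q"
    using T[of x] descent.prems by simp
  moreover have "?q < ?p"
    using pairing_drop[of b "(x, 0)" s] descent by (simp add: af_pairing_fst fst_af_refl)
  ultimately have sgn: "0 < ?p \<and> 0 < ?q \<or> ?p < 0 \<and> ?q < 0"
    by (auto simp: sgn_if split: if_splits)
  have pos: "0 < pairing z x'" if "z \<in> \<Phi>" "0 < pairing z x" for z
    using descent.prems(3) that root_nonzero by (simp add: pairing_gt_0_iff)
  have neg: "pairing z x' < 0" if "z \<in> \<Phi>" "pairing z x < 0" for z
    using pos[of "- z"] that neg_root by (simp add: pairing_minus_left)
  \<comment> \<open>This turns a sign at \<open>?r z\<close> into the sign of another root at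
    \<open>z\<close>, where \<open>pos\<close> and \<open>neg\<close> apply.\<close>
  have move: "pairing (fst s) (?r z) = pairing (?r (fst s)) z" for z
    using pairing_refl[of "fst b" "?r (fst s)" z] by (simp add: refl_refl)
  have "?r (fst s) \<in> \<Phi>"
    using roots refl_root by blast
  then have "sgn ?p' = sgn ?p" "sgn ?q' = sgn ?q" "sgn ?p = sgn ?q"
    using sgn pos neg roots(1) unfolding move by auto
  moreover have "T (?s x') (af_refl s b) = 1"
  proof (rule descent.IH)
    show "0 < pairing (fst (af_refl s b)) (?s x)"
      using descent.prems by (simp add: fst_af_refl pairing_refl)
    show "T (?s x) (af_refl s b) = 1"
      using T[of x] calculation descent.prems by simp
    show "0 < z \<bullet> ?s x'" if "z \<in> \<Phi>" "0 < z \<bullet> ?s x" for z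
      using descent.prems(3)[of "?s z"] that roots refl_root by (simp add: inner_refl_left)
  qed
  ultimately show ?case
    using T[of x'] by simp
qed

end

section \<open>Finite and affine simple roots\<close>

context root_basis
begin

text \<open>The finite system at \<delta>-coefficient \<open>0\<close>, with the height as
  \<open>F\<close>. It yields the effect of simple reflections on \<open>L\<close> and the covers of
  the Bruhat order.\<close>

lemma affine_basis_finite: "affine_basis \<Phi> \<Delta> (fin ` P) (fin ` \<Delta>) (\<lambda>x. fst x \<bullet> v)"
proof (intro affine_basis.intro affine_basis_axioms.intro)
  show "root_basis \<Phi> \<Delta>" ..
next
  show "fin ` \<Delta> \<subseteq> fin ` P"
    using basis_pos by blast
  show "linear (\<lambda>x. fst x \<bullet> v)"
    by (rule linearI) (simp_all add: inner_add_left)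
next
  fix s b assume s: "s \<in> fin ` \<Delta>" and b: "b \<in> fin ` P" "b \<noteq> s"
  then show "af_refl s b \<in> fin ` P"
    using simple_refl_pos
    by (auto simp: fin_def image_iff prod_eq_iff fst_af_refl snd_af_refl)
next
  fix s z assume "s \<in> fin ` \<Delta>" "z \<in> \<Phi>" "z \<noteq> fst s" "z \<noteq> - fst s"
  then show "of_bool (refl (fst s) z \<in> P) = of_bool (z \<in> P) + snd s * pairing (fst s) z"
    using simple_refl_pos_iff by (auto simp: fin_def)
next
  fix b assume "b \<in> fin ` P"
  then obtain c where c: "c \<in> P" "b = fin c"
    by blast
  obtain a where "a \<in> \<Delta>" "0 < a \<bullet> c"
    using exists_simple_inner_pos[OF c(1)] .
  then show "\<exists>s\<in>fin ` \<Delta>. 0 < af_pairing s b"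
    using c basis_subset root_nonzero
    by (auto simp: fin_def af_pairing_fst pairing_gt_0_iff intro!: bexI[of _ a])
qed (use pos_subset basis_pos pos_root_ge_1 in \<open>auto simp: fin_def\<close>)

text \<open>The coefficient of \<open>a\<close> in the positive root \<open>refl a b\<close> is
  \<open>- pairing a b\<close>, so this number is nonnegative.\<close>

lemma basis_obtuse:
  assumes "a \<in> \<Delta>" "b \<in> \<Delta>" "a \<noteq> b"
  shows "a \<bullet> b \<le> 0"
proof -
  obtain u where u: "\<forall>e\<in>\<Delta>. e \<bullet> u = of_bool (e = a)"
    using dual_vector[of "\<lambda>e. of_bool (e = a)"] ..
  have "refl a b \<in> P"
    using assms basis_pos by (intro simple_refl_pos) auto
  then have "0 \<le> refl a b \<bullet> u"
    by (rule nonneg_on_pos) (use u in auto)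
  then have "pairing a b \<le> 0"
    using u assms by (simp add: refl_def inner_diff_left)
  moreover have "a \<noteq> 0"
    using assms basis_subset root_nonzero by blast
  ultimately show ?thesis
    by (simp add: pairing_gt_0_iff flip: not_less)
qed

text \<open>Every reflection in the descent to a simple root is in a root that lies in one part and
  is orthogonal to the other, so undoing it preserves both spans.\<close>

lemma roots_split:
  assumes "S \<subseteq> \<Delta>" and orth: "\<And>a b. a \<in> S \<Longrightarrow> b \<in> \<Delta> - S \<Longrightarrow> a \<bullet> b = 0" and "z \<in> \<Phi>"
  shows "z \<in> span S \<or> z \<in> span (\<Delta> - S)"
proof -
  have orth_span: "a \<bullet> z = 0" if "z \<in> span X" "\<And>x. x \<in> X \<Longrightarrow> a \<bullet> x = 0" for a z X
    using orthogonal_to_span[of z X a] that by (simp add: orthogonal_def)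
  have stay: "b \<in> span X"
    if "refl a b \<in> span X" "a \<in> X \<or> (\<forall>x\<in>X. a \<bullet> x = 0)" for a b X
  proof (cases "a \<in> X")
    case True
    have "refl a b - pairing a (refl a b) *\<^sub>R a \<in> span X"
      by (rule span_diff[OF that(1) span_scale[OF span_base[OF True]]])
    then show ?thesis
      using refl_refl[of a b] by (simp add: refl_def[of a "refl a b"])
  next
    case False
    then have "refl a (refl a b) = refl a b"
      using orth_span[OF that(1)] that(2) by (intro refl_fixes) auto
    with that(1) show ?thesis
      by (simp add: refl_refl)
  qed
  have "b \<in> span S \<or> b \<in> span (\<Delta> - S)" if "b \<in> P" for b
    using that
  proof (induction b rule: pos_root_induct)
    case (basis a)
    then show ?case
      using span_base[of a S] span_base[of a "\<Delta> - S"] by blast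
  next
    case (step a b)
    have "a \<in> S \<or> (\<forall>x\<in>S. a \<bullet> x = 0)" "a \<in> \<Delta> - S \<or> (\<forall>x\<in>\<Delta> - S. a \<bullet> x = 0)"
      using step(1) orth inner_commute by (metis Diff_iff)+
    with step(5) stay[of a b S] stay[of a b "\<Delta> - S"] show ?case
      by blast
  qed
  then show ?thesis
    using root_cases[OF \<open>z \<in> \<Phi>\<close>] span_neg[of "- z"] by force
qed

text \<open>
  \<open>\<theta>\<close> is the highest among the longest roots. Maximal length bounds the pairings with the other
  roots by \<open>1\<close>, and irreducibility makes all coefficients of \<open>\<theta>\<close> positive.
\<close>

lemma exists_theta:
  "\<exists>\<theta>\<in>P.
    (\<forall>z\<in>\<Phi>. z \<noteq> \<theta> \<and> z \<noteq> - \<theta> \<longrightarrow>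
      of_bool (refl \<theta> z \<in> P) = of_bool (z \<in> P) - pairing \<theta> z) \<and>
    (\<forall>z\<in>\<Phi>. (\<forall>a\<in>\<Delta>. a \<bullet> z \<le> 0) \<longrightarrow> \<theta> \<bullet> z < 0)"
proof -
  have "\<Phi> \<noteq> {}"
  proof
    assume "\<Phi> = {}"
    then have "(UNIV :: 'a set) = {0}"
      using span_roots by simp
    moreover obtain e :: 'a where "e \<in> Basis"
      using nonempty_Basis by blast
    ultimately show False
      using nonzero_Basis by blast
  qed
  with finite_roots obtain b where b: "b \<in> \<Phi>" "Max ((\<lambda>z. z \<bullet> z) ` \<Phi>) = b \<bullet> b"
    by (rule obtains_MAX)
  define B where "B = {z \<in> \<Phi>. z \<bullet> z = b \<bullet> b}"
  have "finite B" "B \<noteq> {}"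
    using finite_roots b(1) by (auto simp: B_def)
  then obtain \<theta> where \<theta>: "\<theta> \<in> B" "Max ((\<lambda>z. z \<bullet> v) ` B) = \<theta> \<bullet> v"
    by (rule obtains_MAX)
  have long: "z \<bullet> z \<le> \<theta> \<bullet> \<theta>" if "z \<in> \<Phi>" for z
    using Max_ge[of "(\<lambda>z. z \<bullet> z) ` \<Phi>" "z \<bullet> z"] finite_roots that b(2) \<theta>(1) by (auto simp: B_def)
  have high: "z \<bullet> v \<le> \<theta> \<bullet> v" if "z \<in> B" for z
    using Max_ge[of "(\<lambda>z. z \<bullet> v) ` B" "z \<bullet> v"] \<open>finite B\<close> that \<theta>(2) by auto
  have root: "\<theta> \<in> \<Phi>"
    using \<theta>(1) by (simp add: B_def)
  \<comment> \<open>Comparing the height of \<theta> with that of \<open>- \<theta>\<close> shows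
    that \<theta> is positive; comparing it with simple reflections of \<theta> shows that \<theta>
    is dominant.\<close>
  have "- \<theta> \<in> B"
    using \<theta>(1) by (simp add: B_def neg_root_iff)
  from high[OF this] have pos: "\<theta> \<in> P"
    using root inner_v_nonzero[OF root] by (simp add: pos_root_iff)
  have dom: "0 \<le> a \<bullet> \<theta>" if a: "a \<in> \<Delta>" for a
  proof -
    have "a \<in> \<Phi>"
      using a basis_subset by blast
    then have "refl a \<theta> \<in> B"
      using \<theta>(1) refl_root by (simp add: B_def inner_refl)
    from high[OF this] have "0 \<le> pairing a \<theta>"
      using a by (simp add: refl_def inner_diff_left basis_inner_v)
    then show ?thesis
      using root_nonzero[OF \<open>a \<in> \<Phi>\<close>] by (simp add: pairing_lt_0_iff flip: not_less)
  qed
  have dom_pos: "0 \<le> \<theta> \<bullet> z" if "z \<in> P" for z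
    using nonneg_on_pos[OF that dom] by (simp add: inner_commute)
  obtain c :: "'a \<Rightarrow> nat" where c: "\<theta> = (\<Sum>a\<in>\<Delta>. real (c a) *\<^sub>R a)"
    using pos by (auto simp: pos_roots_def)
  \<comment> \<open>The support of \<theta>. Since \<theta> is dominant and distinct simple roots
    are obtuse, it is orthogonal to the remaining simple roots, and irreducibility makes it all of
    \<open>\<Delta>\<close>.\<close>
  define S where "S = {a \<in> \<Delta>. c a \<noteq> 0}"
  have \<theta>S: "\<theta> \<bullet> x = (\<Sum>a\<in>S. real (c a) * (a \<bullet> x))" for x
    unfolding c inner_sum_left using finite_basis
    by (simp add: S_def) (rule sum.mono_neutral_cong_right, auto)
  have orth: "a \<bullet> i = 0" if "a \<in> S" "i \<in> \<Delta> - S" for a i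
  proof -
    have le: "a \<bullet> i \<le> 0" if "a \<in> S" for a
      using that \<open>i \<in> \<Delta> - S\<close> by (intro basis_obtuse) (auto simp: S_def)
    have "(\<Sum>a\<in>S. real (c a) * (- (a \<bullet> i))) = - (\<theta> \<bullet> i)"
      unfolding \<theta>S by (simp add: sum_negf)
    also have "\<dots> \<le> 0"
      using dom[of i] that by (simp add: inner_commute)
    finally have "(\<Sum>a\<in>S. real (c a) * (- (a \<bullet> i))) = 0"
      using le by (intro antisym sum_nonneg mult_nonneg_nonneg) auto
    then have "\<forall>a\<in>S. real (c a) * (- (a \<bullet> i)) = 0"
      using le finite_basis by (subst (asm) sum_nonneg_eq_0_iff) (auto simp: S_def mult_nonneg_nonpos)
    with that show ?thesis
      by (auto simp: S_def)
  qed
  have "S = \<Delta>"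
  proof (rule ccontr)
    assume "S \<noteq> \<Delta>"
    then obtain i where i: "i \<in> \<Delta> - S"
      unfolding S_def by blast
    have "S \<noteq> {}"
      using \<theta>S[of \<theta>] root_nonzero[OF root] by auto
    have orth': "x \<bullet> y = 0" if "x \<in> span S" "y \<in> span (\<Delta> - S)" for x y
    proof -
      have "x \<bullet> b = 0" if "b \<in> \<Delta> - S" for b
        using orthogonal_to_span[OF \<open>x \<in> span S\<close>, of b] orth that
        by (auto simp: orthogonal_def inner_commute)
      then show ?thesis
        using orthogonal_to_span[OF \<open>y \<in> span (\<Delta> - S)\<close>, of x] by (auto simp: orthogonal_def)
    qed
    have sub: "S \<subseteq> \<Delta>"
      by (auto simp: S_def)
    have "\<exists>x\<in>\<Phi> \<inter> span S. \<exists>y\<in>\<Phi> \<inter> span (\<Delta> - S). x \<bullet> y \<noteq> 0"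
    proof (rule not_decomposable)
      show "\<Phi> \<inter> span S \<noteq> {}"
        using \<open>S \<noteq> {}\<close> sub basis_subset span_superset[of S] by blast
      show "\<Phi> \<inter> span (\<Delta> - S) \<noteq> {}"
        using i basis_subset span_superset[of "\<Delta> - S"] by blast
      show "\<Phi> \<inter> span S \<union> \<Phi> \<inter> span (\<Delta> - S) = \<Phi>"
        using roots_split[OF sub orth] by blast
    qed
    then show False
      using orth' by blast
  qed
  have shift: "of_bool (refl \<theta> z \<in> P) = of_bool (z \<in> P) - pairing \<theta> z"
    if z: "z \<in> P" "z \<noteq> \<theta>" "z \<noteq> - \<theta>" for z
  proof -
    have "z \<in> \<Phi>"
      using z pos_subset by blast
    \<comment> \<open>Expanding this, with \<open>z\<close> no longer than \<theta>, gives \<theta>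
      \<bullet> z < \<theta> \<bullet> \<theta>. The pairing is thus below \<open>2\<close>; being
      integral and nonnegative, it is \<open>0\<close> or \<open>1\<close>.\<close>
    have "0 < (z - \<theta>) \<bullet> (z - \<theta>)"
      using z by simp
    then have lt: "\<theta> \<bullet> z < \<theta> \<bullet> \<theta>"
      using long[OF \<open>z \<in> \<Phi>\<close>] by (simp add: inner_diff_left inner_diff_right inner_commute)
    then have "pairing \<theta> z < 2"
      using root_nonzero[OF root] by (simp add: pairing_def divide_less_eq)
    moreover have "0 \<le> pairing \<theta> z"
      using dom_pos[OF z(1)] by (simp add: pairing_def)
    moreover obtain k where k: "pairing \<theta> z = of_int k"
      using pairing_Ints[OF root \<open>z \<in> \<Phi>\<close>] by (elim Ints_cases)
    ultimately have "k = 0 \<or> k = 1"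
      by auto
    then show ?thesis
    proof
      assume "k = 0"
      with k z show ?thesis
        by (simp add: refl_def)
    next
      assume "k = 1"
      with k have "refl \<theta> z = z - \<theta>"
        by (simp add: refl_def)
      \<comment> \<open>\<theta> is negative on \<open>z - \<theta>\<close> but nonnegative on all
        positive roots.\<close>
      moreover have "z - \<theta> \<notin> P"
        using dom_pos[of "z - \<theta>"] lt by (auto simp: inner_diff_right)
      ultimately show ?thesis
        using k z \<open>k = 1\<close> by simp
    qed
  qed
  show ?thesis
  proof (intro bexI[OF _ pos] conjI ballI impI)
    fix z assume z: "z \<in> \<Phi>" and "z \<noteq> \<theta> \<and> z \<noteq> - \<theta>"
    then have ne: "z \<noteq> \<theta>" "z \<noteq> - \<theta>"
      by auto
    show "of_bool (refl \<theta> z \<in> P) = of_bool (z \<in> P) - pairing \<theta> z"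
    proof (cases "z \<in> P")
      case False
      then have "of_bool (refl \<theta> (- z) \<in> P) = of_bool (- z \<in> P) - pairing \<theta> (- z)"
        using z ne neg_pos_iff by (intro shift) auto
      then show ?thesis
        using False z refl_root[OF root z]
        by (simp add: refl_minus pairing_minus neg_pos_iff of_bool_def split: if_splits)
    qed (use shift ne in blast)
  next
    fix z assume z: "z \<in> \<Phi>" and anti: "\<forall>a\<in>\<Delta>. a \<bullet> z \<le> 0"
    have "\<theta> \<bullet> z \<le> 0"
      unfolding \<theta>S using anti \<open>S = \<Delta>\<close> by (intro sum_nonpos mult_nonneg_nonpos) auto
    \<comment> \<open>All coefficients of \<theta> are positive, so equality would make
      \<open>z\<close> orthogonal to every simple root and hence to itself.\<close>
    moreover have "\<theta> \<bullet> z \<noteq> 0"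
    proof
      assume "\<theta> \<bullet> z = 0"
      then have "(\<Sum>a\<in>S. real (c a) * (- (a \<bullet> z))) = 0"
        unfolding \<theta>S by (simp add: sum_negf)
      then have "\<forall>a\<in>S. real (c a) * (- (a \<bullet> z)) = 0"
        using anti \<open>S = \<Delta>\<close> finite_basis
        by (subst (asm) sum_nonneg_eq_0_iff) (auto simp: mult_nonneg_nonpos)
      then have 0: "a \<bullet> z = 0" if "a \<in> \<Delta>" for a
        using that \<open>S = \<Delta>\<close> by (auto simp: S_def)
      have "b \<bullet> z = 0" if "b \<in> P" for b
        using nonneg_on_pos[OF that, of z] nonneg_on_pos[OF that, of "- z"] 0 by simp
      then have "z \<bullet> z = 0"
        using root_cases[OF z] by force
      with z root_nonzero show False
        by auto
    qed
    ultimately show "\<theta> \<bullet> z < 0"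
      by simp
  qed
qed

section \<open>Positive affine roots and simple affine roots\<close>

lemma af_pos_roots_iff:
  "b \<in> af_pos_roots \<Phi> \<Delta> \<longleftrightarrow> fst b \<in> \<Phi> \<and> snd b \<in> \<int> \<and> 1 \<le> snd b + of_bool (fst b \<in> P)"
proof -
  have *: "b \<in> af_pos_roots \<Phi> \<Delta> \<longleftrightarrow>
      fst b \<in> P \<and> snd b = 0 \<or> fst b \<in> \<Phi> \<and> (\<exists>n. n > 0 \<and> snd b = of_int n)"
    by (auto simp: af_pos_roots_def fin_def null_root_def image_iff prod_eq_iff)
  show ?thesis
  proof
    assume "b \<in> af_pos_roots \<Phi> \<Delta>"
    then show "fst b \<in> \<Phi> \<and> snd b \<in> \<int> \<and> 1 \<le> snd b + of_bool (fst b \<in> P)"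
      using pos_subset unfolding * by auto
  next
    assume b: "fst b \<in> \<Phi> \<and> snd b \<in> \<int> \<and> 1 \<le> snd b + of_bool (fst b \<in> P)"
    then obtain n where "snd b = of_int n"
      by (auto elim: Ints_cases)
    with b show "b \<in> af_pos_roots \<Phi> \<Delta>"
      unfolding * by (cases "n = 0") (auto simp: of_bool_def split: if_splits)
  qed
qed

text \<open>One argument for all simple affine roots: away from \<plusminus> \<open>fst s\<close>,
  the positivity threshold moves exactly along with the \<delta>-coefficient.\<close>

lemma af_pos_refl:
  assumes s: "fst s \<in> \<Phi>" and b: "b \<in> af_pos_roots \<Phi> \<Delta>" "b \<noteq> s"
    and shift: "\<And>z. z \<in> \<Phi> \<Longrightarrow> z \<noteq> fst s \<Longrightarrow> z \<noteq> - fst s \<Longrightarrow>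
      of_bool (refl (fst s) z \<in> P) = of_bool (z \<in> P) + snd s * pairing (fst s) z"
    and self: "of_bool (fst s \<in> P) + snd s = (1::real)"
  shows "af_refl s b \<in> af_pos_roots \<Phi> \<Delta>"
proof -
  have root: "fst b \<in> \<Phi>" and int: "snd b \<in> \<int>" and ge: "1 \<le> snd b + of_bool (fst b \<in> P)"
    using b by (auto simp: af_pos_roots_iff)
  have snd_s: "snd s = 1 - of_bool (fst s \<in> P)"
    using self by simp
  then have "snd (af_refl s b) \<in> \<int>"
    using int pairing_Ints[OF s root] by (auto simp: snd_af_refl of_bool_def)
  moreover have "fst (af_refl s b) \<in> \<Phi>"
    using refl_root s root by (simp add: fst_af_refl)
  moreover have "1 \<le> snd (af_refl s b) + of_bool (fst (af_refl s b) \<in> P)"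
  proof -
    consider "fst b = fst s" | "fst b = - fst s" | "fst b \<noteq> fst s" "fst b \<noteq> - fst s"
      by blast
    then show ?thesis
    proof cases
      case 1
      then have "snd b \<noteq> snd s"
        using b by (auto simp: prod_eq_iff)
      moreover obtain n where "snd b = of_int n"
        using int by (elim Ints_cases)
      \<comment> \<open>\<open>s\<close> sits on the threshold and \<open>b \<noteq> s\<close>, so
        by integrality \<open>b\<close> is at least one level above it, which is exactly what its
        mirror image requires.\<close>
      ultimately have "2 \<le> snd b + of_bool (fst s \<in> P)"
        using ge 1 snd_s by (auto simp: of_bool_def split: if_splits)
      with 1 show ?thesis
        using s root_nonzero neg_pos_iff[OF s] snd_s
        by (auto simp: fst_af_refl snd_af_refl refl_self pairing_self)
    next
      case 2
      then show ?thesis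
        using ge s root_nonzero neg_pos_iff[OF s] snd_s
        by (auto simp: fst_af_refl snd_af_refl refl_self refl_minus pairing_minus pairing_self
            of_bool_def split: if_splits)
    next
      case 3
      with ge shift[OF root] show ?thesis
        by (simp add: fst_af_refl snd_af_refl algebra_simps)
    qed
  qed
  ultimately show ?thesis
    by (simp add: af_pos_roots_iff)
qed

text \<open>The simple affine roots are \<open>\<Delta>\<close> together with
  \<open>\<delta> - fin \<theta>\<close>; \<open>F\<close> is the height plus \<open>N\<close> times
  the \<delta>-coefficient.\<close>

lemma affine_basis_affine:
  obtains S F where "affine_basis \<Phi> \<Delta> (af_pos_roots \<Phi> \<Delta>) S F"
proof -
  obtain \<theta> where \<theta>: "\<theta> \<in> P"
    and shift: "\<forall>z\<in>\<Phi>. z \<noteq> \<theta> \<and> z \<noteq> - \<theta> \<longrightarrow>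
      of_bool (refl \<theta> z \<in> P) = of_bool (z \<in> P) - pairing \<theta> z"
    and anti: "\<forall>z\<in>\<Phi>. (\<forall>a\<in>\<Delta>. a \<bullet> z \<le> 0) \<longrightarrow> \<theta> \<bullet> z < 0"
    using exists_theta by blast
  have "\<theta> \<in> \<Phi>"
    using \<theta> pos_subset by blast
  define S where "S = fin ` \<Delta> \<union> {\<delta> - fin \<theta>}"
  \<comment> \<open>\<open>N - 1\<close> bounds the height of every positive root, so a negative
    root plus \<delta> still has \<open>F\<close> at least \<open>1\<close>.\<close>
  define N where "N = 1 + (\<Sum>z\<in>P. z \<bullet> v)"
  have S_cases: "(\<exists>a\<in>\<Delta>. s = (a, 0)) \<or> s = (- \<theta>, 1)" if "s \<in> S" for s
    using that by (auto simp: S_def fin_def null_root_def)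
  have S_root: "fst s \<in> \<Phi>" if "s \<in> S" for s
    using S_cases[OF that] basis_subset \<open>\<theta> \<in> \<Phi>\<close> neg_root by auto
  have S_shift: "of_bool (refl (fst s) z \<in> P) = of_bool (z \<in> P) + snd s * pairing (fst s) z"
    if "s \<in> S" "z \<in> \<Phi>" "z \<noteq> fst s" "z \<noteq> - fst s" for s z
    using S_cases[OF that(1)] that(2-) bspec[OF shift, of z] simple_refl_pos_iff[of "fst s" z]
    by (auto simp: refl_minus_left pairing_minus_left)
  have S_self: "of_bool (fst s \<in> P) + snd s = 1" if "s \<in> S" for s
    using S_cases[OF that] \<theta> basis_pos neg_pos_iff[OF \<open>\<theta> \<in> \<Phi>\<close>] by auto
  have S_subset: "S \<subseteq> af_pos_roots \<Phi> \<Delta>"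
  proof
    fix s assume s: "s \<in> S"
    have "snd s \<in> \<int>"
      using S_cases[OF s] by auto
    with S_root[OF s] S_self[OF s] show "s \<in> af_pos_roots \<Phi> \<Delta>"
      by (simp add: af_pos_roots_iff add.commute)
  qed
  have N: "z \<bullet> v \<le> N - 1" if "z \<in> P" for z
    using member_le_sum[of z P "\<lambda>z. z \<bullet> v"] that pos_root_ge_1 finite_subset[OF pos_subset finite_roots]
    by (force simp: N_def)
  have "affine_basis \<Phi> \<Delta> (af_pos_roots \<Phi> \<Delta>) S (\<lambda>x. fst x \<bullet> v + N * snd x)"
  proof (intro affine_basis.intro affine_basis_axioms.intro)
    show "root_basis \<Phi> \<Delta>" ..
  next
    show "linear (\<lambda>x. fst x \<bullet> v + N * snd x)"
      by (rule linearI) (simp_all add: inner_add_left algebra_simps)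
  next
    fix b assume b: "b \<in> af_pos_roots \<Phi> \<Delta>"
    then have root: "fst b \<in> \<Phi>" and ge: "1 \<le> snd b + of_bool (fst b \<in> P)"
      by (auto simp: af_pos_roots_iff)
    have "0 \<le> N"
      using N[OF \<theta>] pos_root_ge_1[OF \<theta>] by simp
    show "1 \<le> fst b \<bullet> v + N * snd b"
    proof (cases "fst b \<in> P")
      case True
      then show ?thesis
        using pos_root_ge_1[OF True] ge \<open>0 \<le> N\<close> by (simp add: add_increasing2)
    next
      case False
      then have "- fst b \<bullet> v \<le> N - 1"
        using N[of "- fst b"] neg_pos_iff[OF root] by simp
      moreover have "N * 1 \<le> N * snd b"
        using False ge \<open>0 \<le> N\<close> by (intro mult_left_mono) auto
      ultimately show ?thesis
        by simp
    qed
  next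
    fix b assume b: "b \<in> af_pos_roots \<Phi> \<Delta>"
    then have root: "fst b \<in> \<Phi>"
      by (simp add: af_pos_roots_iff)
    show "\<exists>s\<in>S. 0 < af_pairing s b"
    proof (cases "\<exists>a\<in>\<Delta>. 0 < a \<bullet> fst b")
      case True
      then obtain a where "a \<in> \<Delta>" "0 < a \<bullet> fst b"
        by blast
      then have "fin a \<in> S" "0 < af_pairing (fin a) b"
        using basis_subset root_nonzero
        by (auto simp: S_def af_pairing_fst fin_def pairing_gt_0_iff)
      then show ?thesis ..
    next
      case False
      then have "\<theta> \<bullet> fst b < 0"
        using anti root by (meson not_le)
      then have "0 < af_pairing (\<delta> - fin \<theta>) b"
        using \<open>\<theta> \<in> \<Phi>\<close> root_nonzero
        by (simp add: af_pairing_fst fin_def null_root_def pairing_gt_0_iff)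
      then show ?thesis
        by (auto simp: S_def)
    qed
  next
    fix s b assume "s \<in> S" "b \<in> af_pos_roots \<Phi> \<Delta>" "b \<noteq> s"
    then show "af_refl s b \<in> af_pos_roots \<Phi> \<Delta>"
      using af_pos_refl S_root S_shift S_self by blast
  qed (simp_all add: S_subset S_shift S_self af_pos_roots_iff)
  then show thesis
    by (rule that)
qed

section \<open>Weyl group and length\<close>

abbreviation W :: "('a \<Rightarrow> 'a) set" where "W \<equiv> weyl_group \<Phi>"

text \<open>By descent: \<open>refl b\<close> is the conjugate of \<open>refl (refl a b)\<close> by
  \<open>refl a\<close>.\<close>

lemma refl_simple_word:
  assumes "b \<in> \<Phi>"
  shows "\<exists>as. set as \<subseteq> \<Delta> \<and> refl b = word refl as"
proof -
  have pos: "\<exists>as. set as \<subseteq> \<Delta> \<and> refl b = word refl as" if "b \<in> P" for b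
    using that
  proof (induction b rule: pos_root_induct)
    case (basis a)
    then show ?case
      by (intro exI[of _ "[a]"]) simp
  next
    case (step a b)
    then obtain as where as: "set as \<subseteq> \<Delta>" "refl (refl a b) = word refl as"
      by blast
    have "refl b = word refl (a # as @ [a])"
    proof
      fix x
      show "refl b x = word refl (a # as @ [a]) x"
        using refl_conj[of a "refl a b" "refl a x"] by (simp add: word_append refl_refl flip: as(2))
    qed
    with as step(1) show ?case
      by (intro exI[of _ "a # as @ [a]"]) simp
  qed
  show ?thesis
    using root_cases[OF assms] pos[of b] pos[of "- b"] by (auto simp: refl_minus_left)
qed

lemma weyl_eq: "W = {word refl as | as. set as \<subseteq> \<Delta>}"
proof -
  have "\<exists>bs. set bs \<subseteq> \<Delta> \<and> word refl as = word refl bs" if "set as \<subseteq> \<Phi>" for as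
    using that
  proof (induction as)
    case (Cons a as)
    then obtain bs where bs: "set bs \<subseteq> \<Delta>" "word refl as = word refl bs"
      by auto
    obtain cs where "set cs \<subseteq> \<Delta>" "refl a = word refl cs"
      using refl_simple_word[of a] Cons.prems by auto
    with bs show ?case
      by (intro exI[of _ "cs @ bs"]) (simp add: word_append)
  qed (auto intro: exI[of _ "[]"])
  then show ?thesis
    using basis_subset unfolding weyl_group_def generated_group_def by fast
qed

lemma weyl_cases:
  assumes "w \<in> W"
  obtains as where "set as \<subseteq> \<Delta>" "w = word refl as"
  using assms unfolding weyl_eq by blast

lemma word_in_weyl: "set as \<subseteq> \<Delta> \<Longrightarrow> word refl as \<in> W"
  unfolding weyl_eq by blast

lemma id_in_weyl: "id \<in> W"
  using word_in_weyl[of "[]"] by simp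

lemma refl_in_weyl: "b \<in> \<Phi> \<Longrightarrow> refl b \<in> W"
  using refl_simple_word word_in_weyl by metis

lemma comp_in_weyl: "u \<in> W \<Longrightarrow> w \<in> W \<Longrightarrow> u \<circ> w \<in> W"
  by (elim weyl_cases) (metis set_append Un_least word_append word_in_weyl)

lemma weyl_orthogonal: "w \<in> W \<Longrightarrow> orthogonal_transformation w"
  by (elim weyl_cases) (simp add: orthogonal_transformation_word)

lemma weyl_bij: "w \<in> W \<Longrightarrow> bij w"
  using weyl_orthogonal orthogonal_transformation_bij by blast

lemma inv_in_weyl:
  assumes "w \<in> W"
  shows "inv w \<in> W"
proof -
  obtain as where as: "set as \<subseteq> \<Delta>" "w = word refl as"
    using assms by (rule weyl_cases)
  have "inv w = word refl (rev as)"
    using word_rev[of as] word_rev[of "rev as"] as(2) by (intro inv_unique_comp) simp_all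
  with as(1) show ?thesis
    by (simp add: word_in_weyl)
qed

lemma weyl_inv_left [simp]: "w \<in> W \<Longrightarrow> inv w (w x) = x"
  using weyl_bij bij_is_inj inv_f_f by metis

lemma weyl_inv_right [simp]: "w \<in> W \<Longrightarrow> w (inv w x) = x"
  using weyl_bij bij_is_surj surj_f_inv_f by metis

lemma weyl_inner: "w \<in> W \<Longrightarrow> w x \<bullet> w y = x \<bullet> y"
  using weyl_orthogonal by (simp add: orthogonal_transformation_def)

lemma weyl_inner_right: "w \<in> W \<Longrightarrow> x \<bullet> w y = inv w x \<bullet> y"
  using weyl_inner[of w "inv w x" y] by simp

lemma weyl_root: "w \<in> W \<Longrightarrow> b \<in> \<Phi> \<Longrightarrow> w b \<in> \<Phi>"
proof -
  have "word refl as b \<in> \<Phi>" if "set as \<subseteq> \<Delta>" "b \<in> \<Phi>" for as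
    using that by (induction as) (use basis_subset refl_root in auto)
  then show "w \<in> W \<Longrightarrow> b \<in> \<Phi> \<Longrightarrow> w b \<in> \<Phi>"
    by (auto elim: weyl_cases)
qed

lemma weyl_refl: "w \<in> W \<Longrightarrow> w \<circ> refl b = refl (w b) \<circ> w"
  using refl_orthogonal[OF weyl_orthogonal] by (simp add: fun_eq_iff)

lemma L_card: "L x = real (card {z \<in> P. z \<bullet> x < 0})"
proof -
  have "L x = (\<Sum>z\<in>{z \<in> P. z \<bullet> x < 0}. 1)"
    unfolding L_def using pos_subset finite_roots by (intro sum.mono_neutral_cong_right) auto
  then show ?thesis
    by simp
qed

lemma finite_pos: "finite P"
  using pos_subset finite_roots finite_subset by auto

lemma L_v: "L v = 0"
proof -
  have "{z \<in> P. z \<bullet> v < 0} = {}"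
    using pos_root_ge_1 by force
  then show ?thesis
    unfolding L_card by (simp only: card.empty of_nat_0)
qed

lemma L_simple:
  assumes "a \<in> \<Delta>"
  shows "L (refl a x) = L x + sgn (pairing a x)"
proof -
  interpret finite: affine_basis \<Phi> \<Delta> "fin ` P" "fin ` \<Delta>" "\<lambda>x. fst x \<bullet> v"
    by (rule affine_basis_finite)
  show ?thesis
    using finite.T_S[of "fin a" x] assms by (simp add: T_def fin_def)
qed

text \<open>The exchange condition. \<open>b\<close> is positive on \<open>v\<close> and negative on
  its image, so on being moved through the word it must at some point equal the next letter, which
  then cancels.\<close>

lemma exchange:
  assumes "set as \<subseteq> \<Delta>" "b \<in> P" "b \<bullet> word refl as v < 0"
  shows "\<exists>bs. set bs \<subseteq> \<Delta> \<and> Suc (length bs) = length as \<and> refl b \<circ> word refl as = word refl bs"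
  using assms
proof (induction as arbitrary: b)
  case Nil
  then show ?case
    using pos_root_ge_1[of b] by simp
next
  case (Cons a as)
  show ?case
  proof (cases "b = a")
    case True
    then show ?thesis
      using Cons.prems by (intro exI[of _ as]) (simp add: fun_eq_iff refl_refl)
  next
    case False
    then have "refl a b \<in> P" "refl a b \<bullet> word refl as v < 0"
      using Cons.prems simple_refl_pos by (simp_all add: inner_refl_left)
    then obtain bs where bs: "set bs \<subseteq> \<Delta>" "Suc (length bs) = length as"
      "refl (refl a b) \<circ> word refl as = word refl bs"
      using Cons.IH[of "refl a b"] Cons.prems(1) by (metis list.set_intros(2) subset_iff)
    have eq: "refl b \<circ> word refl (a # as) = word refl (a # bs)"
      using refl_conj[of a "refl a b"] by (auto simp: fun_eq_iff refl_refl simp flip: bs(3))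
    show ?thesis
      using bs Cons.prems(1) by (intro exI[of _ "a # bs"] conjI eq) simp_all
  qed
qed

lemma len_le: "set as \<subseteq> \<Delta> \<Longrightarrow> len \<Delta> (word refl as) \<le> length as"
  unfolding len_def by (rule Least_le) blast

lemma len_word:
  assumes "w \<in> W"
  obtains as where "set as \<subseteq> \<Delta>" "length as = len \<Delta> w" "w = word refl as"
proof -
  have "\<exists>n. \<exists>as. set as \<subseteq> \<Delta> \<and> length as = n \<and> w = word refl as"
    using assms by (auto elim: weyl_cases)
  then have "\<exists>as. set as \<subseteq> \<Delta> \<and> length as = len \<Delta> w \<and> w = word refl as"
    unfolding len_def by (rule LeastI_ex)
  then show thesis
    using that by blast
qed

text \<open>The length hypothesis says that the word is reduced, and so is its tail. Prefixing a
  letter raises \<open>L\<close> by one, since a negative pairing would let the exchange condition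
  shorten the word.\<close>

lemma L_reduced_word:
  assumes "set as \<subseteq> \<Delta>" "length as \<le> len \<Delta> (word refl as)"
  shows "L (word refl as v) = length as"
  using assms
proof (induction as)
  case Nil
  then show ?case
    by (simp add: L_v)
next
  case (Cons a as)
  let ?u = "word refl as"
  have a: "a \<in> \<Delta>" "a \<in> P" "a \<in> \<Phi>"
    using Cons.prems basis_pos basis_subset by auto
  have "length as \<le> len \<Delta> ?u"
  proof (rule ccontr)
    assume less: "\<not> ?thesis"
    have "?u \<in> W"
      using Cons.prems word_in_weyl by simp
    then obtain bs where bs: "set bs \<subseteq> \<Delta>" "length bs = len \<Delta> ?u" "?u = word refl bs"
      by (rule len_word)
    have eq: "word refl (a # as) = word refl (a # bs)"
      using bs(3) by simp
    have "len \<Delta> (word refl (a # as)) \<le> length (a # bs)"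
      unfolding eq using bs a by (intro len_le) simp
    with Cons.prems(2) bs(2) less show False
      by (simp del: word_Cons)
  qed
  then have IH: "L (?u v) = length as"
    using Cons by simp
  have "\<not> a \<bullet> ?u v < 0"
  proof
    assume "a \<bullet> ?u v < 0"
    then obtain bs where bs: "set bs \<subseteq> \<Delta>" "Suc (length bs) = length as"
      "refl a \<circ> ?u = word refl bs"
      using exchange[of as a] Cons.prems a by auto
    with len_le[OF bs(1)] Cons.prems show False
      by simp
  qed
  moreover have "a \<bullet> ?u v \<noteq> 0"
    using inner_v_nonzero[OF weyl_root[OF inv_in_weyl]] word_in_weyl Cons.prems a(3)
    by (simp add: weyl_inner_right)
  ultimately have "0 < pairing a (?u v)"
    using root_nonzero[OF a(3)] by (simp add: pairing_gt_0_iff)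
  with IH L_simple[OF a(1)] show ?case
    by simp
qed

lemma len_eq_L: "w \<in> W \<Longrightarrow> real (len \<Delta> w) = L (w v)"
  by (elim len_word) (use L_reduced_word in force)

lemma weyl_eq_id:
  assumes "w \<in> W" "L (w v) = 0"
  shows "w = id"
proof -
  obtain as where "set as \<subseteq> \<Delta>" "length as = len \<Delta> w" "w = word refl as"
    using assms(1) by (rule len_word)
  moreover have "len \<Delta> w = 0"
    using len_eq_L[OF assms(1)] assms(2) by simp
  ultimately show ?thesis
    by simp
qed

text \<open>\<open>v\<close> has trivial stabilizer: \<open>inv u \<circ> w\<close> fixes
  \<open>v\<close>, so it makes no positive root negative and has length \<open>0\<close>.\<close>

lemma weyl_eqI:
  assumes "u \<in> W" "w \<in> W" "u v = w v"
  shows "u = w"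
proof -
  have "inv u \<circ> w = id"
    using assms by (intro weyl_eq_id) (simp_all add: comp_in_weyl inv_in_weyl L_v flip: assms(3))
  then show ?thesis
    using assms(1) by (metis comp_id fun.map_comp fun_eq_iff comp_apply id_apply weyl_inv_right)
qed

lemma len_descent:
  assumes "w \<in> W" "w \<noteq> id"
  shows "\<exists>a\<in>\<Delta>. a \<bullet> w v < 0 \<and> len \<Delta> (refl a \<circ> w) < len \<Delta> w"
proof -
  obtain as where as: "set as \<subseteq> \<Delta>" "length as = len \<Delta> w" "w = word refl as"
    using assms(1) by (rule len_word)
  with assms(2) obtain a bs where "as = a # bs"
    by (cases as) auto
  with as have a: "a \<in> \<Delta>" and bs: "set bs \<subseteq> \<Delta>" "Suc (length bs) = len \<Delta> w"
    and w: "w = refl a \<circ> word refl bs"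
    by simp_all
  have u: "refl a \<circ> w = word refl bs"
    by (simp add: w fun_eq_iff refl_refl)
  have less: "len \<Delta> (refl a \<circ> w) < len \<Delta> w"
    using len_le[OF bs(1)] bs(2) u by simp
  have "a \<in> \<Phi>"
    using a basis_subset by blast
  have "L (refl a (w v)) < L (w v)"
    using less len_eq_L[OF assms(1)] len_eq_L[OF comp_in_weyl[OF refl_in_weyl[OF \<open>a \<in> \<Phi>\<close>] assms(1)]]
    by simp
  then have "pairing a (w v) < 0"
    unfolding L_simple[OF a] by (simp add: sgn_if split: if_splits)
  then have "a \<bullet> w v < 0"
    using root_nonzero[OF \<open>a \<in> \<Phi>\<close>] by (simp add: pairing_lt_0_iff)
  with a less show ?thesis
    by blast
qed

lemma weyl_inner_v_nonzero: "w \<in> W \<Longrightarrow> b \<in> \<Phi> \<Longrightarrow> b \<bullet> w v \<noteq> 0"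
  using inner_v_nonzero weyl_root inv_in_weyl by (simp add: weyl_inner_right)

section \<open>Covers in the Bruhat order\<close>

lemma bruhat_less_len: "bruhat_less \<Phi> \<Delta> x y \<Longrightarrow> len \<Delta> x < len \<Delta> y"
  unfolding bruhat_less_def by (induction rule: tranclp_induct) auto

text \<open>Length is strictly monotone, so a difference of one gives a cover. Conversely,
  \<open>w \<mapsto> w v\<close> carries a cover to one in the order of the finite system, where
  \<open>T\<close> shows that \<open>L\<close> rises by exactly one.\<close>

lemma covers_bruhat_iff:
  assumes w: "w \<in> W" and g: "g \<in> \<Phi>"
  shows "covers (bruhat_less \<Phi> \<Delta>) w (w \<circ> refl g) \<longleftrightarrow> len \<Delta> (w \<circ> refl g) = len \<Delta> w + 1"
proof
  assume eq: "len \<Delta> (w \<circ> refl g) = len \<Delta> w + 1"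
  then have "bruhat_less \<Phi> \<Delta> w (w \<circ> refl g)"
    using w g unfolding bruhat_less_def by auto
  moreover have "\<not> (bruhat_less \<Phi> \<Delta> w z \<and> bruhat_less \<Phi> \<Delta> z (w \<circ> refl g))" for z
    using bruhat_less_len[of w z] bruhat_less_len[of z "w \<circ> refl g"] eq by auto
  ultimately show "covers (bruhat_less \<Phi> \<Delta>) w (w \<circ> refl g)"
    by (auto simp: covers_def)
next
  interpret finite: affine_basis \<Phi> \<Delta> "fin ` P" "fin ` \<Delta>" "\<lambda>x. fst x \<bullet> v"
    by (rule affine_basis_finite)
  have L_less: "L x < L (refl b x)" if "b \<in> P" "0 < pairing b x" for b x
    using finite.T_and_covers[of "fin b" "(x, 0)"] that
    by (simp add: af_pairing_fst fin_def T_def)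
  \<comment> \<open>Steps on the orbit of \<open>v\<close> lift to the Bruhat order, because
    \<open>refl b\<close> on the left of \<open>u\<close> is \<open>refl (inv u b)\<close> on its
    right.\<close>
  have up: "\<exists>u'\<in>W. z = fin (u' v) \<and> bruhat_less \<Phi> \<Delta> u u'"
    if st: "finite.step (fin (u v)) z" and u: "u \<in> W" for u z
  proof -
    obtain b' where b': "b' \<in> fin ` P" "0 < af_pairing b' (fin (u v))" "z = af_refl b' (fin (u v))"
      using st by (rule finite.stepE)
    obtain b where "b \<in> P" "b' = fin b"
      using b'(1) by (rule imageE)
    with b' have b: "b \<in> P" "0 < pairing b (u v)" "z = af_refl (fin b) (fin (u v))"
      by (simp_all add: af_pairing_fst fin_def)
    have "b \<in> \<Phi>"
      using b pos_subset by blast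
    then have W: "refl b \<circ> u \<in> W"
      using u comp_in_weyl refl_in_weyl by blast
    have eq: "refl b \<circ> u = u \<circ> refl (inv u b)"
      using weyl_refl[OF u, of "inv u b"] u by simp
    have root: "inv u b \<in> \<Phi>"
      by (rule weyl_root[OF inv_in_weyl[OF u] \<open>b \<in> \<Phi>\<close>])
    have longer: "len \<Delta> u < len \<Delta> (refl b \<circ> u)"
      using L_less[OF b(1,2)] len_eq_L[OF u] len_eq_L[OF W] by simp
    have "bruhat_less \<Phi> \<Delta> u (refl b \<circ> u)"
      unfolding bruhat_less_def
      by (intro tranclp.r_into_trancl conjI bexI[of _ "inv u b"] u eq root longer)
    moreover have "z = fin ((refl b \<circ> u) v)"
      using b(3) by (simp add: prod_eq_iff fst_af_refl snd_af_refl fin_def)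
    ultimately show ?thesis
      using W by blast
  qed
  have chain: "\<exists>u'\<in>W. z = fin (u' v) \<and> bruhat_less \<Phi> \<Delta> u u'"
    if "finite.lt (fin (u v)) z" and u: "u \<in> W" for u z
    using that(1)
  proof (induction rule: tranclp_induct)
    case (base y)
    then show ?case
      using up u by blast
  next
    case (step y z)
    then obtain u' where u': "u' \<in> W" "y = fin (u' v)" "bruhat_less \<Phi> \<Delta> u u'"
      by blast
    obtain u'' where "u'' \<in> W" "z = fin (u'' v)" "bruhat_less \<Phi> \<Delta> u' u''"
      using up[of u' z] step(2) u' by blast
    moreover from this u'(3) have "bruhat_less \<Phi> \<Delta> u u''"
      unfolding bruhat_less_def by (blast intro: tranclp_trans)
    ultimately show ?case
      by blast
  qed
  assume cov: "covers (bruhat_less \<Phi> \<Delta>) w (w \<circ> refl g)"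
  \<comment> \<open>Steps are labeled by positive roots; \<open>w g\<close> and its negative have
    the same reflection.\<close>
  define c where "c = (if w g \<in> P then w g else - w g)"
  have c: "c \<in> P" "w \<circ> refl g = refl c \<circ> w"
    using root_cases[OF weyl_root[OF w g]] weyl_refl[OF w, of g] by (auto simp: c_def refl_minus_left)
  then have "c \<in> \<Phi>"
    using pos_subset by blast
  then have W: "refl c \<circ> w \<in> W"
    using w comp_in_weyl refl_in_weyl by blast
  have "len \<Delta> w < len \<Delta> (refl c \<circ> w)"
    using cov bruhat_less_len c(2) by (simp add: covers_def)
  then have L: "L (w v) < L (refl c (w v))"
    using len_eq_L[OF w] len_eq_L[OF W] by simp
  have pos: "0 < pairing c (w v)"
  proof (rule ccontr)
    assume "\<not> ?thesis"
    then have "c \<bullet> w v < 0"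
      using root_nonzero[OF \<open>c \<in> \<Phi>\<close>] weyl_inner_v_nonzero[OF w \<open>c \<in> \<Phi>\<close>]
      by (simp add: pairing_gt_0_iff)
    then have "0 < pairing c (refl c (w v))"
      using root_nonzero[OF \<open>c \<in> \<Phi>\<close>]
      by (simp add: pairing_gt_0_iff refl_self flip: inner_refl_left)
    from L_less[OF c(1) this] L show False
      by (simp add: refl_refl)
  qed
  have "covers finite.lt (fin (w v)) (af_refl (fin c) (fin (w v)))"
  proof -
    have y: "af_refl (fin c) (fin (w v)) = fin ((w \<circ> refl g) v)"
      unfolding c(2) by (simp add: prod_eq_iff fst_af_refl snd_af_refl fin_def)
    have "finite.step (fin (w v)) (af_refl (fin c) (fin (w v)))"
      using c(1) pos unfolding finite.step_def
      by (intro bexI[of _ "fin c"]) (auto simp: af_pairing_fst fin_def)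
    moreover have False if wz: "finite.lt (fin (w v)) z" and zy: "finite.lt z (fin ((w \<circ> refl g) v))" for z
    proof -
      obtain u where u: "u \<in> W" "z = fin (u v)" "bruhat_less \<Phi> \<Delta> w u"
        using chain[OF wz w] by blast
      obtain u' where u': "u' \<in> W" "fin ((w \<circ> refl g) v) = fin (u' v)" "bruhat_less \<Phi> \<Delta> u u'"
        using chain[OF zy[unfolded u(2)] u(1)] by blast
      have "w \<circ> refl g = u'"
        using u' W c(2) by (intro weyl_eqI) (auto simp: fin_def)
      with u u' cov show False
        by (auto simp: covers_def)
    qed
    ultimately show ?thesis
      unfolding covers_def y by blast
  qed
  then have "T (w v) (fin c) = 1"
    using finite.T_and_covers[of "fin c" "fin (w v)"] c(1) pos by (simp add: af_pairing_fst fin_def)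
  then have "L ((refl c \<circ> w) v) = L (w v) + 1"
    by (simp add: T_def fin_def)
  then have "real (len \<Delta> (refl c \<circ> w)) = real (len \<Delta> w + 1)"
    using len_eq_L[OF w] len_eq_L[OF W] by simp
  then show "len \<Delta> (w \<circ> refl g) = len \<Delta> w + 1"
    unfolding c(2) of_nat_eq_iff .
qed

end

section \<open>Minimal coset representatives\<close>

locale dominant_weight = root_basis +
  fixes lam :: 'a
  assumes dominant: "dominant \<Delta> lam"
begin

abbreviation J :: "'a set" where "J \<equiv> singular_nodes \<Delta> lam"

lemma basis_inner_lam:
  assumes "a \<in> \<Delta>"
  shows "0 \<le> a \<bullet> lam"
proof -
  have "a \<noteq> 0"
    using assms basis_subset root_nonzero by blast
  moreover have "\<not> pairing a lam < 0"
    using dominant assms by (simp add: dominant_def not_less)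
  ultimately show ?thesis
    by (simp add: pairing_lt_0_iff)
qed

lemma J_iff: "a \<in> J \<longleftrightarrow> a \<in> \<Delta> \<and> a \<bullet> lam = 0"
  using basis_subset root_nonzero by (auto simp: singular_nodes_def pairing_def)

lemma pos_inner_lam: "b \<in> P \<Longrightarrow> 0 \<le> b \<bullet> lam"
  using nonneg_on_pos basis_inner_lam by blast

lemma inner_lam_pos_imp: "b \<in> \<Phi> \<Longrightarrow> 0 < b \<bullet> lam \<Longrightarrow> b \<in> P"
  using root_cases[of b] pos_inner_lam[of "- b"] by auto

text \<open>\<open>lam\<close> lies in the closure of the chamber of \<open>v\<close>, so strict
  signs at \<open>w lam\<close> persist at \<open>w v\<close>.\<close>

lemma weyl_inner_lam_v: "w \<in> W \<Longrightarrow> z \<in> \<Phi> \<Longrightarrow> 0 < z \<bullet> w lam \<Longrightarrow> 0 < z \<bullet> w v"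
  using inner_lam_pos_imp[of "inv w z"] weyl_root[OF inv_in_weyl]
  by (simp add: weyl_inner_right pos_root_iff)

lemma weyl_inner_lam_v_neg: "w \<in> W \<Longrightarrow> z \<in> \<Phi> \<Longrightarrow> z \<bullet> w lam < 0 \<Longrightarrow> z \<bullet> w v < 0"
  using weyl_inner_lam_v[of w "- z"] neg_root by simp

text \<open>Induction on length: if \<open>u\<close> fixes \<open>lam\<close>, a left descent
  \<open>a\<close> of \<open>u\<close> is not positive on \<open>u lam = lam\<close>. By dominance
  it is orthogonal to \<open>lam\<close>, so it lies in \<open>J\<close> and can be stripped
  off.\<close>

lemma parabolic_eq: "parabolic J = {u \<in> W. u lam = lam}"
proof (intro equalityI subsetI)
  fix u assume "u \<in> parabolic J"
  then obtain as where as: "set as \<subseteq> J" "u = word refl as"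
    by (auto simp: parabolic_def generated_group_def)
  then have "word refl as lam = lam"
    by (induction as arbitrary: u) (auto simp: J_iff refl_fixes)
  moreover have "u \<in> W"
    using as by (auto simp: J_iff subset_iff intro!: word_in_weyl)
  ultimately show "u \<in> {u \<in> W. u lam = lam}"
    using as by simp
next
  fix u assume "u \<in> {u \<in> W. u lam = lam}"
  then have "u \<in> W" "u lam = lam"
    by auto
  then show "u \<in> parabolic J"
  proof (induction "len \<Delta> u" arbitrary: u rule: less_induct)
    case less
    show ?case
    proof (cases "u = id")
      case True
      then show ?thesis
        unfolding parabolic_def generated_group_def by (auto intro!: exI[of _ "[]"])
    next
      case False
      obtain a where a: "a \<in> \<Delta>" "a \<bullet> u v < 0" "len \<Delta> (refl a \<circ> u) < len \<Delta> u"
        using len_descent[OF less.prems(1) False] by blast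
      have "a \<in> \<Phi>"
        using a basis_subset by blast
      have "\<not> 0 < a \<bullet> u lam"
        using weyl_inner_lam_v[OF less.prems(1) \<open>a \<in> \<Phi>\<close>] a(2) by auto
      then have "a \<bullet> lam = 0"
        using basis_inner_lam[OF a(1)] less.prems(2) by simp
      then have "a \<in> J" "(refl a \<circ> u) lam = lam"
        using a(1) less.prems(2) by (auto simp: J_iff refl_fixes)
      moreover from this have "refl a \<circ> u \<in> parabolic J"
        using less.hyps[OF a(3)] comp_in_weyl[OF refl_in_weyl[OF \<open>a \<in> \<Phi>\<close>] less.prems(1)] by simp
      then obtain as where as: "set as \<subseteq> J" "refl a \<circ> u = word refl as"
        by (auto simp: parabolic_def generated_group_def)
      have "u = word refl (a # as)"
        by (simp flip: as(2) add: fun_eq_iff refl_refl)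
      ultimately show ?thesis
        using as(1) unfolding parabolic_def generated_group_def
        by (intro CollectI exI[of _ "a # as"]) simp
    qed
  qed
qed

lemma coset_iff:
  assumes "v0 \<in> W"
  shows "(\<exists>u\<in>parabolic J. w = v0 \<circ> u) \<longleftrightarrow> w \<in> W \<and> w lam = v0 lam"
proof
  assume "w \<in> W \<and> w lam = v0 lam"
  then show "\<exists>u\<in>parabolic J. w = v0 \<circ> u"
    using assms unfolding parabolic_eq
    by (intro bexI[of _ "inv v0 \<circ> w"]) (auto simp: fun_eq_iff comp_in_weyl inv_in_weyl)
qed (use assms in \<open>auto simp: parabolic_eq comp_in_weyl\<close>)

lemma L_le_len:
  assumes "w \<in> W"
  shows "L (w lam) \<le> real (len \<Delta> w)"
  unfolding len_eq_L[OF assms] L_card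
  using weyl_inner_lam_v_neg[OF assms] pos_subset finite_pos by (auto intro!: card_mono)

text \<open>A positive root negative on \<open>w v\<close> but not on \<open>w lam\<close> would be
  orthogonal to \<open>w lam\<close>; its reflection would stay in the coset and shorten
  \<open>w\<close> by exchange. Conversely, \<open>L (w lam)\<close> bounds all lengths in the coset
  from below.\<close>

lemma min_reps_eq: "min_reps \<Phi> \<Delta> J = {w \<in> W. real (len \<Delta> w) = L (w lam)}"
proof (intro equalityI subsetI)
  fix w assume "w \<in> min_reps \<Phi> \<Delta> J"
  then have w: "w \<in> W" and min: "\<And>u. u \<in> parabolic J \<Longrightarrow> len \<Delta> w \<le> len \<Delta> (w \<circ> u)"
    by (auto simp: min_reps_def)
  have "z \<bullet> w lam < 0" if z: "z \<in> P" "z \<bullet> w v < 0" for z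
  proof (rule ccontr)
    assume "\<not> ?thesis"
    have "z \<in> \<Phi>"
      using z pos_subset by blast
    then have "\<not> 0 < z \<bullet> w lam"
      using weyl_inner_lam_v[OF w, of z] z(2) by auto
    with \<open>\<not> z \<bullet> w lam < 0\<close> have "z \<bullet> w lam = 0"
      by simp
    then have "(refl z \<circ> w) lam = w lam"
      by (simp add: refl_fixes)
    then obtain u where u: "u \<in> parabolic J" "refl z \<circ> w = w \<circ> u"
      using coset_iff[OF w] comp_in_weyl[OF refl_in_weyl[OF \<open>z \<in> \<Phi>\<close>] w] by blast
    obtain as where as: "set as \<subseteq> \<Delta>" "length as = len \<Delta> w" "w = word refl as"
      using w by (rule len_word)
    then obtain bs where "set bs \<subseteq> \<Delta>" "Suc (length bs) = len \<Delta> w" "refl z \<circ> w = word refl bs"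
      using exchange[OF as(1) z(1)] z(2) by auto
    with len_le[of bs] min[OF u(1)] u(2) show False
      by simp
  qed
  then have "{z \<in> P. z \<bullet> w v < 0} = {z \<in> P. z \<bullet> w lam < 0}"
    using weyl_inner_lam_v_neg[OF w] pos_subset by blast
  then have "L (w v) = L (w lam)"
    unfolding L_card by (simp only:)
  then show "w \<in> {w \<in> W. real (len \<Delta> w) = L (w lam)}"
    using w by (simp add: len_eq_L)
next
  fix w assume "w \<in> {w \<in> W. real (len \<Delta> w) = L (w lam)}"
  then have w: "w \<in> W" and len: "real (len \<Delta> w) = L (w lam)"
    by auto
  have "len \<Delta> w \<le> len \<Delta> (w \<circ> u)" if "u \<in> parabolic J" for u
    using L_le_len[of "w \<circ> u"] that w len by (simp add: parabolic_eq comp_in_weyl)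
  with w show "w \<in> min_reps \<Phi> \<Delta> J"
    by (simp add: min_reps_def)
qed

text \<open>For a minimal representative, the positive roots negative on \<open>w v\<close> are
  those negative on \<open>w lam\<close>. The two candidates thus share them, so
  \<open>inv w \<circ> w'\<close> makes no positive root negative.\<close>

lemma min_reps_unique:
  assumes "w \<in> min_reps \<Phi> \<Delta> J" "w' \<in> min_reps \<Phi> \<Delta> J" "w lam = w' lam"
  shows "w = w'"
proof -
  have W: "w \<in> W" "w' \<in> W"
    using assms by (auto simp: min_reps_eq)
  have eq: "{z \<in> P. z \<bullet> u v < 0} = {z \<in> P. z \<bullet> u lam < 0}" if "u \<in> min_reps \<Phi> \<Delta> J" for u
  proof (rule card_subset_eq[symmetric])
    have u: "u \<in> W" "L (u v) = L (u lam)"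
      using that by (auto simp: min_reps_eq len_eq_L)
    show "{z \<in> P. z \<bullet> u lam < 0} \<subseteq> {z \<in> P. z \<bullet> u v < 0}"
      using weyl_inner_lam_v_neg[OF u(1)] pos_subset by blast
    show "card {z \<in> P. z \<bullet> u lam < 0} = card {z \<in> P. z \<bullet> u v < 0}"
      using u(2) by (simp add: L_card)
  qed (simp add: finite_pos)
  have pos: "z \<bullet> w v < 0 \<longleftrightarrow> z \<bullet> w' v < 0" if "z \<in> P" for z
    using eq[OF assms(1)] eq[OF assms(2)] assms(3) that by auto
  have "\<not> z \<bullet> inv w (w' v) < 0" if "z \<in> P" for z
  proof -
    have z: "z \<in> \<Phi>" "w z \<in> \<Phi>"
      using that pos_subset weyl_root[OF W(1)] by auto
    have "0 < w z \<bullet> w v"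
      using that pos_root_ge_1[OF that] W by (simp add: weyl_inner)
    then have "\<not> w z \<bullet> w' v < 0"
      using root_cases[OF z(2)] pos[of "w z"] pos[of "- w z"]
        weyl_inner_v_nonzero[OF W(2) z(2)] by auto
    then show ?thesis
      using weyl_inner[OF W(1), of z "inv w (w' v)"] W(1) by simp
  qed
  then have "{z \<in> P. z \<bullet> (inv w \<circ> w') v < 0} = {}"
    by auto
  then have "L ((inv w \<circ> w') v) = 0"
    unfolding L_card by (simp only: card.empty of_nat_0)
  then have "inv w \<circ> w' = id"
    using W comp_in_weyl inv_in_weyl weyl_eq_id by blast
  then show ?thesis
    using W by (metis comp_apply ext id_apply weyl_inv_right)
qed

lemma min_reps_exists:
  assumes "w0 \<in> W"
  shows "\<exists>w\<in>min_reps \<Phi> \<Delta> J. w lam = w0 lam"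
proof -
  let ?C = "\<lambda>w. w \<in> W \<and> w lam = w0 lam"
  define w where "w = (ARG_MIN (len \<Delta>) w. ?C w)"
  have w: "?C w" and min: "\<And>u. ?C u \<Longrightarrow> len \<Delta> w \<le> len \<Delta> u"
    unfolding w_def using assms arg_min_natI[of ?C w0 "len \<Delta>"] arg_min_nat_le[of ?C _ "len \<Delta>"] by auto
  have "len \<Delta> w \<le> len \<Delta> (w \<circ> u)" if "u \<in> parabolic J" for u
    using that w by (intro min) (auto simp: parabolic_eq comp_in_weyl)
  with w show ?thesis
    by (intro bexI[of _ w]) (auto simp: min_reps_def)
qed

lemma cl_rep_works:
  assumes "u \<in> W" "cl m = u lam"
  shows "cl_rep \<Phi> \<Delta> lam m \<in> min_reps \<Phi> \<Delta> J \<and> cl_rep \<Phi> \<Delta> lam m lam = cl m"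
proof -
  have "\<exists>!w. w \<in> min_reps \<Phi> \<Delta> J \<and> w lam = cl m"
    using min_reps_exists[OF assms(1)] min_reps_unique assms(2) by metis
  then show ?thesis
    unfolding cl_rep_def by (rule theI')
qed

text \<open>The cosets of the stabilizer are the fibres of \<open>w \<mapsto> w lam\<close>.\<close>

lemma min_rep_eq_cl_rep:
  assumes "u \<in> W" "cl m = u lam"
  shows "min_rep \<Phi> \<Delta> J u = cl_rep \<Phi> \<Delta> lam m"
proof -
  have "w \<in> min_reps \<Phi> \<Delta> J \<and> (\<exists>x\<in>parabolic J. w = u \<circ> x)
      \<longleftrightarrow> w \<in> min_reps \<Phi> \<Delta> J \<and> w lam = cl m" for w
    unfolding coset_iff[OF assms(1)] assms(2) by (auto simp: min_reps_def)
  then show ?thesis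
    unfolding min_rep_def cl_rep_def by simp
qed

section \<open>Covers and edges of the quantum Bruhat graph\<close>

text \<open>If a nonnegative combination of simple roots is orthogonal to the dominant
  \<open>lam\<close>, its coefficients outside \<open>J\<close> vanish.\<close>

lemma pos_roots_J: "pos_roots \<Phi> J = {b \<in> P. b \<bullet> lam = 0}"
proof (intro equalityI subsetI)
  fix b assume "b \<in> pos_roots \<Phi> J"
  then obtain c :: "'a \<Rightarrow> nat" where b: "b \<in> \<Phi>" and c: "b = (\<Sum>a\<in>J. real (c a) *\<^sub>R a)"
    by (auto simp: pos_roots_def)
  have "b \<bullet> lam = 0"
    by (simp add: c inner_sum_left J_iff)
  moreover have "0 \<le> b \<bullet> v"
    unfolding c inner_sum_left using basis_inner_v by (intro sum_nonneg) (auto simp: J_iff)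
  then have "b \<in> P"
    using inner_v_nonzero[OF b] b by (simp add: pos_root_iff)
  ultimately show "b \<in> {b \<in> P. b \<bullet> lam = 0}"
    by simp
next
  fix b assume "b \<in> {b \<in> P. b \<bullet> lam = 0}"
  then obtain c :: "'a \<Rightarrow> nat" where b: "b \<in> \<Phi>" "b \<bullet> lam = 0" and c: "b = (\<Sum>a\<in>\<Delta>. real (c a) *\<^sub>R a)"
    by (auto simp: pos_roots_def)
  have "(\<Sum>a\<in>\<Delta>. real (c a) * (a \<bullet> lam)) = 0"
    using b(2) by (simp add: c inner_sum_left)
  then have "\<forall>a\<in>\<Delta>. real (c a) * (a \<bullet> lam) = 0"
    using finite_basis basis_inner_lam by (subst (asm) sum_nonneg_eq_0_iff) auto
  then have "b = (\<Sum>a\<in>J. real (c a) *\<^sub>R a)"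
    unfolding c using finite_basis by (intro sum.mono_neutral_right) (auto simp: J_iff)
  with b show "b \<in> pos_roots \<Phi> J"
    by (auto simp: pos_roots_def)
qed

lemma pos_diff_iff: "b \<in> P - pos_roots \<Phi> J \<longleftrightarrow> b \<in> \<Phi> \<and> 0 < b \<bullet> lam"
  using pos_inner_lam[of b] inner_lam_pos_imp[of b] pos_subset by (auto simp: pos_roots_J)

text \<open>Removing \<open>pos_roots \<Phi> J\<close> from \<open>P\<close> leaves the roots
  positive on \<open>lam\<close>, the negatives of those summed in \<open>R lam\<close>.\<close>

lemma two_rho_eq: "2 *\<^sub>R half_sum P - 2 *\<^sub>R half_sum (pos_roots \<Phi> J) = - R lam"
proof -
  have sub: "pos_roots \<Phi> J \<subseteq> P"
    by (auto simp: pos_roots_J)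
  have "2 *\<^sub>R half_sum P - 2 *\<^sub>R half_sum (pos_roots \<Phi> J) = (\<Sum>z\<in>P - pos_roots \<Phi> J. z)"
    using sum_diff[OF finite_pos sub, of "\<lambda>z. z"] by (simp add: half_sum_def)
  also have "P - pos_roots \<Phi> J = {z \<in> \<Phi>. 0 < z \<bullet> lam}"
    using pos_diff_iff by blast
  also have "(\<Sum>z\<in>{z \<in> \<Phi>. 0 < z \<bullet> lam}. z) = (\<Sum>z | z \<in> \<Phi> \<and> z \<bullet> lam < 0. - z)"
    by (rule sum.reindex_bij_witness[of _ uminus uminus]) (auto simp: neg_root)
  finally show ?thesis
    by (simp add: R_def sum_negf)
qed

lemma R_weyl:
  assumes w: "w \<in> W"
  shows "R (w x) = w (R x)"
proof -
  obtain as where as: "set as \<subseteq> \<Delta>" "w = word refl as"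
    using w by (rule weyl_cases)
  have "R (word refl as x) = word refl as (R x)"
    using as(1) by (induction as) (use basis_subset R_refl in auto)
  with as show ?thesis
    by simp
qed

text \<open>Both lengths are values of \<open>L\<close> by \<open>min_reps_eq\<close>, and
  equivariance of \<open>R\<close> turns the \<rho> term into the \<delta>-term of
  \<open>T\<close>.\<close>

lemma qb_edge_down_iff:
  assumes w: "w \<in> min_reps \<Phi> \<Delta> J" and g: "g \<in> P - pos_roots \<Phi> J"
  shows "qb_edge_down \<Phi> \<Delta> J w g w' \<longleftrightarrow>
    w' = min_rep \<Phi> \<Delta> J (w \<circ> refl g) \<and> T (w lam) (w g, 1) = 1"
proof -
  have "g \<in> \<Phi>"
    using g by (simp only: pos_diff_iff)
  then have W: "w \<in> W" "w \<circ> refl g \<in> W" and len: "real (len \<Delta> w) = L (w lam)"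
    using w by (simp_all add: min_reps_eq refl_in_weyl comp_in_weyl)
  let ?w' = "min_rep \<Phi> \<Delta> J (w \<circ> refl g)"
  have "?w' \<in> min_reps \<Phi> \<Delta> J \<and> ?w' lam = (w \<circ> refl g) lam"
    using cl_rep_works[of "w \<circ> refl g" "fin ((w \<circ> refl g) lam)"]
      min_rep_eq_cl_rep[of "w \<circ> refl g" "fin ((w \<circ> refl g) lam)"] W by (simp add: cl_def fin_def)
  then have "real (len \<Delta> ?w') = L (refl (w g) (w lam))"
    using fun_cong[OF weyl_refl[OF W(1), of g], of lam] by (simp add: min_reps_eq)
  moreover have "pairing g (R lam) = pairing (w g) (R (w lam))"
    unfolding R_weyl[OF W(1)] pairing_orthogonal[OF weyl_orthogonal[OF W(1)]] ..
  ultimately show ?thesis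
    using w g len unfolding qb_edge_down_def two_rho_eq by (auto simp: T_def pairing_minus)
qed

text \<open>Bruhat covers are decided at \<open>w v\<close>, but \<open>T\<close> is taken at
  \<open>w lam\<close>. \<open>T_eq_1_transfer\<close> leads to \<open>w v\<close>; in the other
  direction \<open>L_le_len\<close> bounds \<open>T\<close> by \<open>1\<close> from above and
  \<open>T_ge\<close> from below.\<close>

lemma qb_edge_up_iff:
  assumes w: "w \<in> min_reps \<Phi> \<Delta> J" and g: "g \<in> P - pos_roots \<Phi> J"
  shows "qb_edge_up \<Phi> \<Delta> J w g w' \<longleftrightarrow>
    w' = min_rep \<Phi> \<Delta> J (w \<circ> refl g) \<and> w g \<in> P \<and> T (w lam) (fin (w g)) = 1"
proof -
  interpret finite: affine_basis \<Phi> \<Delta> "fin ` P" "fin ` \<Delta>" "\<lambda>x. fst x \<bullet> v"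
    by (rule affine_basis_finite)
  have root: "g \<in> \<Phi>" and pos: "0 < g \<bullet> lam"
    using g by (simp_all only: pos_diff_iff)
  then have W: "w \<in> W" "w \<circ> refl g \<in> W" and len: "real (len \<Delta> w) = L (w lam)"
    using w by (simp_all add: min_reps_eq refl_in_weyl comp_in_weyl)
  let ?a = "w g"
  have a: "?a \<in> \<Phi>" "?a \<noteq> 0"
    using weyl_root[OF W(1) root] root_nonzero by auto
  have pair: "0 < pairing ?a (w lam)" "0 < pairing ?a (w v)"
    using pos g pos_root_ge_1[of g] a(2) W(1)
    by (auto simp: pairing_gt_0_iff weyl_inner)
  have eq: "w \<circ> refl g = refl ?a \<circ> w"
    by (rule weyl_refl[OF W(1)])
  have len': "real (len \<Delta> (w \<circ> refl g)) = L (refl ?a (w v))"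
    using len_eq_L[OF W(2)] fun_cong[OF eq, of v] by simp
  have T_ge: "1 \<le> T x (fin b)" if "b \<in> P" "0 < pairing b x" for b x
    using finite.T_and_covers[of "fin b" "(x, 0)"] that by (simp add: af_pairing_fst fin_def)
  have "len \<Delta> (w \<circ> refl g) = len \<Delta> w + 1 \<longleftrightarrow> ?a \<in> P \<and> T (w lam) (fin ?a) = 1"
  proof
    assume "?a \<in> P \<and> T (w lam) (fin ?a) = 1"
    then have "T (w v) (fin ?a) = 1"
      using finite.T_eq_1_transfer[of "fin ?a" "w lam" "w v"] pair weyl_inner_lam_v[OF W(1)]
      by (simp add: fin_def)
    then have "real (len \<Delta> (w \<circ> refl g)) = real (len \<Delta> w + 1)"
      using len' len_eq_L[OF W(1)] by (simp add: T_def fin_def)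
    then show "len \<Delta> (w \<circ> refl g) = len \<Delta> w + 1"
      unfolding of_nat_eq_iff .
  next
    assume *: "len \<Delta> (w \<circ> refl g) = len \<Delta> w + 1"
    \<comment> \<open>Otherwise the positive root \<open>- ?a\<close> would lead from
      \<open>refl ?a (w v)\<close> up to \<open>w v\<close>, making \<open>w \<circ> refl g\<close>
      shorter than \<open>w\<close>.\<close>
    have "?a \<in> P"
    proof (rule ccontr)
      assume "?a \<notin> P"
      then have "- ?a \<in> P"
        using neg_pos_iff a(1) by blast
      moreover have "0 < pairing (- ?a) (refl ?a (w v))"
        using pair(2) pairing_refl[of ?a ?a "w v"] by (simp add: refl_self)
      ultimately have "1 \<le> T (refl ?a (w v)) (fin (- ?a))"
        by (rule T_ge)
      then have "L (refl ?a (w v)) + 1 \<le> L (w v)"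
        by (simp add: T_def fin_def refl_minus_left refl_refl)
      with * len' len_eq_L[OF W(1)] show False
        by simp
    qed
    moreover have "L (refl ?a (w lam)) \<le> L (w lam) + 1"
      using L_le_len[OF W(2)] * len eq by (simp add: fun_eq_iff)
    ultimately show "?a \<in> P \<and> T (w lam) (fin ?a) = 1"
      using T_ge[OF _ pair(1)] by (simp add: T_def fin_def)
  qed
  then show ?thesis
    using w g covers_bruhat_iff[OF W(1) root] unfolding qb_edge_up_def by auto
qed

section \<open>The level-zero orbit, its order and the labels\<close>

lemma af_pos_root_imp_af_root: "b \<in> af_pos_roots \<Phi> \<Delta> \<Longrightarrow> b \<in> af_roots \<Phi>"
proof -
  have "fin a = fin a + of_int 0 *\<^sub>R \<delta>" for a :: 'a
    by simp
  then have "fin ` P \<subseteq> af_roots \<Phi>"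
    using pos_subset unfolding af_roots_def by blast
  then show "b \<in> af_pos_roots \<Phi> \<Delta> \<Longrightarrow> b \<in> af_roots \<Phi>"
    unfolding af_pos_roots_def af_roots_def by blast
qed

lemma af_refl_lz_weights:
  assumes "m \<in> lz_weights \<Phi> lam" "b \<in> af_roots \<Phi>"
  shows "af_refl b m \<in> lz_weights \<Phi> lam"
proof -
  obtain as where "set as \<subseteq> af_roots \<Phi>" "m = word af_refl as (fin lam)"
    using assms(1) by (auto simp: lz_weights_def af_weyl_group_def generated_group_def)
  with assms(2) have "set (b # as) \<subseteq> af_roots \<Phi>" "af_refl b m = word af_refl (b # as) (fin lam)"
    by auto
  then show ?thesis
    unfolding lz_weights_def af_weyl_group_def generated_group_def by blast
qed

lemma cl_lz_weights:
  assumes "m \<in> lz_weights \<Phi> lam"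
  shows "\<exists>u\<in>W. cl m = u lam"
proof -
  obtain as where as: "set as \<subseteq> af_roots \<Phi>" "m = word af_refl as (fin lam)"
    using assms by (auto simp: lz_weights_def af_weyl_group_def generated_group_def)
  have "\<exists>u\<in>W. cl (word af_refl as (fin lam)) = u lam"
    using as(1)
  proof (induction as)
    case Nil
    then show ?case
      using id_in_weyl by (auto simp: cl_def fin_def intro!: bexI[of _ id])
  next
    case (Cons b as)
    then obtain u where u: "u \<in> W" "cl (word af_refl as (fin lam)) = u lam"
      by auto
    have "fst b \<in> \<Phi>"
      using Cons.prems by (auto simp: af_roots_def fin_def null_root_def)
    then have "refl (fst b) \<circ> u \<in> W"
      using u comp_in_weyl refl_in_weyl by blast
    moreover have "cl (word af_refl (b # as) (fin lam)) = (refl (fst b) \<circ> u) lam"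
      using u(2) by (simp add: cl_def fst_af_refl)
    ultimately show ?case
      by blast
  qed
  with as show ?thesis
    by simp
qed

text \<open>Two candidate labels are proportional, so they are equal or opposite; an affine root and
  its negative are never both positive.\<close>

lemma cover_label_eq:
  assumes b: "b \<in> af_pos_roots \<Phi> \<Delta>" and pos: "0 < af_pairing b m"
  shows "cover_label \<Phi> \<Delta> m (af_refl b m) = b"
  unfolding cover_label_def
proof (rule the_equality)
  fix b' assume b': "b' \<in> af_pos_roots \<Phi> \<Delta> \<and> af_refl b m = af_refl b' m"
  let ?c = "af_pairing b' m / af_pairing b m"
  have "af_pairing b m *\<^sub>R b = af_pairing b' m *\<^sub>R b'"
    using b' by (simp add: af_refl_def)
  then have "(1 / af_pairing b m) *\<^sub>R (af_pairing b m *\<^sub>R b) = (1 / af_pairing b m) *\<^sub>R (af_pairing b' m *\<^sub>R b')"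
    by simp
  then have eq: "b = ?c *\<^sub>R b'"
    using pos by simp
  then have fst: "fst b = ?c *\<^sub>R fst b'"
    by (metis fst_scaleR)
  have roots: "fst b \<in> \<Phi>" "fst b' \<in> \<Phi>"
    using b b' by (auto simp: af_pos_roots_iff)
  have "?c = 1 \<or> ?c = -1"
    using multiple_root[OF roots(2), of ?c] roots(1) fst by metis
  then show "b' = b"
  proof
    assume c: "?c = -1"
    have "b = - b'"
      using eq unfolding c by simp
    with b b' neg_pos_iff[OF roots(2)] show ?thesis
      by (auto simp: af_pos_roots_iff of_bool_def split: if_splits)
  qed (use eq in simp)
qed (use b in simp)

end

locale dominant_weight_affine = dominant_weight +
  fixes S :: "('a \<times> real) set" and F :: "'a \<times> real \<Rightarrow> real"
  assumes affine_basis: "affine_basis \<Phi> \<Delta> (af_pos_roots \<Phi> \<Delta>) S F"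
begin

sublocale affine_basis \<Phi> \<Delta> "af_pos_roots \<Phi> \<Delta>" S F
  by (rule affine_basis)

abbreviation X :: "('a \<times> real) set" where "X \<equiv> lz_weights \<Phi> lam"

lemma step_in_X:
  assumes "m \<in> X" "step m n"
  shows "n \<in> X"
  using assms(2) by (rule stepE) (use assms(1) af_refl_lz_weights af_pos_root_imp_af_root in blast)

text \<open>The orbit is closed under steps, so requiring every source to lie in it only constrains
  the starting point.\<close>

lemma lz_less_iff: "lz_less \<Phi> \<Delta> lam m n \<longleftrightarrow> m \<in> X \<and> lt m n"
proof -
  have eq: "lz_less \<Phi> \<Delta> lam = (\<lambda>m n. m \<in> X \<and> step m n)\<^sup>+\<^sup>+"
    unfolding lz_less_def step_def ..
  show ?thesis
  proof
    assume "lz_less \<Phi> \<Delta> lam m n"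
    then show "m \<in> X \<and> lt m n"
      unfolding eq by (induction rule: tranclp_induct) (auto intro: tranclp.trancl_into_trancl)
  next
    assume "m \<in> X \<and> lt m n"
    then have "lt m n" "m \<in> X"
      by auto
    then have "n \<in> X \<and> lz_less \<Phi> \<Delta> lam m n"
      unfolding eq
    proof (induction rule: tranclp_induct)
      case (step y z)
      then show ?case
        using step_in_X[of y z] tranclp.trancl_into_trancl[of "\<lambda>m n. m \<in> X \<and> step m n" m y z] by auto
    qed (use step_in_X in auto)
    then show "lz_less \<Phi> \<Delta> lam m n" ..
  qed
qed

lemma lt_in_X:
  assumes "m \<in> X" "lt m n"
  shows "n \<in> X"
  using assms(2) by (induction rule: tranclp_induct) (use assms(1) step_in_X in blast)+

lemma lz_cover_iff: "m \<in> X \<Longrightarrow> lz_cover \<Phi> \<Delta> lam m n \<longleftrightarrow> covers lt m n"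
  unfolding lz_cover_def covers_def lz_less_iff using lt_in_X by blast

text \<open>The first step of a chain from \<open>m\<close> to \<open>n\<close> cannot end strictly
  between them.\<close>

lemma covers_imp_step:
  assumes "covers lt m n"
  shows "step m n"
proof -
  have "lt m n"
    using assms by (simp add: covers_def)
  then obtain z where z: "step m z" "le z n"
    using tranclpD by metis
  then have "z = n"
    using assms unfolding le_iff covers_def by blast
  with z show ?thesis
    by simp
qed

lemma T_shift: "T x (a, n) = T x (a, n') - (n - n') * pairing a (R x)"
  by (simp add: T_def algebra_simps)

text \<open>Already at the least \<delta>-coefficient of a positive root in this direction
  \<open>T\<close> is at least \<open>1\<close>. It strictly increases with this coefficient by
  \<open>pairing_R_neg\<close>, so it equals \<open>1\<close> at most there.\<close>

lemma label_cases:
  assumes b: "b \<in> af_pos_roots \<Phi> \<Delta>" and pos: "0 < pairing (fst b) x" and T: "T x b = 1"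
  shows "fst b \<in> P \<and> snd b = 0 \<or> - fst b \<in> P \<and> snd b = 1"
proof -
  define n :: real where "n = 1 - of_bool (fst b \<in> P)"
  have root: "fst b \<in> \<Phi>" and ge: "n \<le> snd b"
    using b by (auto simp: af_pos_roots_iff n_def)
  have "(fst b, n) \<in> af_pos_roots \<Phi> \<Delta>"
    using root by (simp add: af_pos_roots_iff n_def of_bool_def)
  then have "1 \<le> T x (fst b, n)"
    using T_and_covers[of "(fst b, n)" "(x, 0)"] pos by (simp add: af_pairing_fst)
  then have "0 \<le> (snd b - n) * pairing (fst b) (R x)"
    using T T_shift[of x "fst b" "snd b" n] by simp
  then have "snd b = n"
    using pairing_R_neg[OF root pos] ge by (auto simp: zero_le_mult_iff)
  then show ?thesis
    using neg_pos_iff[OF root] by (auto simp: n_def)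
qed

theorem quantum_bruhat_covers:
  assumes m: "m \<in> X" and w: "w = cl_rep \<Phi> \<Delta> lam m"
  shows
    "(\<forall>n b. lz_cover \<Phi> \<Delta> lam m n \<and> b = cover_label \<Phi> \<Delta> m n \<longrightarrow>
       (b \<in> fin ` P \<or> b \<in> (\<lambda>\<alpha>. \<delta> - fin \<alpha>) ` P) \<and>
       (b \<in> fin ` P \<longrightarrow>
          inv w (cl b) \<in> P - pos_roots \<Phi> J \<and>
          qb_edge_up \<Phi> \<Delta> J w (inv w (cl b)) (cl_rep \<Phi> \<Delta> lam n)) \<and>
       (b \<in> (\<lambda>\<alpha>. \<delta> - fin \<alpha>) ` P \<longrightarrow>
          inv w (cl (b - \<delta>)) \<in> P - pos_roots \<Phi> J \<and>
          qb_edge_down \<Phi> \<Delta> J w (inv w (cl (b - \<delta>))) (cl_rep \<Phi> \<Delta> lam n))) \<and>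
    (\<forall>g \<in> P - pos_roots \<Phi> J. \<forall>w'.
       (qb_edge_up \<Phi> \<Delta> J w g w' \<longrightarrow>
          (\<exists>n. lz_cover \<Phi> \<Delta> lam m n \<and> cover_label \<Phi> \<Delta> m n = fin (w g) \<and>
               cl_rep \<Phi> \<Delta> lam n = w')) \<and>
       (qb_edge_down \<Phi> \<Delta> J w g w' \<longrightarrow>
          (\<exists>n. lz_cover \<Phi> \<Delta> lam m n \<and> cover_label \<Phi> \<Delta> m n = \<delta> + fin (w g) \<and>
               cl_rep \<Phi> \<Delta> lam n = w')))"
proof -
  obtain u where "u \<in> W" "cl m = u lam"
    using cl_lz_weights[OF m] by blast
  then have min: "w \<in> min_reps \<Phi> \<Delta> J" and wm: "w lam = fst m"
    using cl_rep_works[of u m] w by (simp_all add: cl_def)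
  have W: "w \<in> W"
    using min by (simp add: min_reps_eq)
  \<comment> \<open>On cosets, reflecting \<open>m\<close> in a root with finite part
    \<open>w g\<close> is right multiplication by \<open>refl g\<close>, whatever the
    \<delta>-coefficient.\<close>
  have target: "cl_rep \<Phi> \<Delta> lam (af_refl b m) = min_rep \<Phi> \<Delta> J (w \<circ> refl g)"
    if "g \<in> \<Phi>" "fst b = w g" for b g
    using that weyl_refl[OF W, of g] wm
    by (intro min_rep_eq_cl_rep[symmetric])
      (simp_all add: comp_in_weyl refl_in_weyl W cl_def fst_af_refl fun_eq_iff)
  have fin_iff: "b \<in> fin ` P \<longleftrightarrow> fst b \<in> P \<and> snd b = 0"
    and delta_iff: "b \<in> (\<lambda>\<alpha>. \<delta> - fin \<alpha>) ` P \<longleftrightarrow> - fst b \<in> P \<and> snd b = 1" for b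
    by (force simp: fin_def null_root_def image_iff prod_eq_iff)+
  have forward: "(b \<in> fin ` P \<or> b \<in> (\<lambda>\<alpha>. \<delta> - fin \<alpha>) ` P) \<and>
       (b \<in> fin ` P \<longrightarrow>
          inv w (cl b) \<in> P - pos_roots \<Phi> J \<and>
          qb_edge_up \<Phi> \<Delta> J w (inv w (cl b)) (cl_rep \<Phi> \<Delta> lam n)) \<and>
       (b \<in> (\<lambda>\<alpha>. \<delta> - fin \<alpha>) ` P \<longrightarrow>
          inv w (cl (b - \<delta>)) \<in> P - pos_roots \<Phi> J \<and>
          qb_edge_down \<Phi> \<Delta> J w (inv w (cl (b - \<delta>))) (cl_rep \<Phi> \<Delta> lam n))"
    if cov: "lz_cover \<Phi> \<Delta> lam m n" and label: "b = cover_label \<Phi> \<Delta> m n" for n b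
  proof -
    have cov': "covers lt m n"
      using cov lz_cover_iff[OF m] by blast
    obtain b' where b': "b' \<in> af_pos_roots \<Phi> \<Delta>" "0 < af_pairing b' m" "n = af_refl b' m"
      using covers_imp_step[OF cov'] by (rule stepE)
    with label have b: "b \<in> af_pos_roots \<Phi> \<Delta>" "0 < af_pairing b m" "n = af_refl b m"
      by (simp_all add: cover_label_eq)
    have root: "fst b \<in> \<Phi>"
      using b(1) by (simp add: af_pos_roots_iff)
    have T: "T (w lam) b = 1"
      using T_and_covers[OF b(1,2)] cov' b(3) wm by simp
    let ?g = "inv w (fst b)"
    have g: "?g \<in> \<Phi>"
      by (rule weyl_root[OF inv_in_weyl[OF W] root])
    have "0 < fst b \<bullet> w lam"
      using b(2) root_nonzero[OF root] wm by (simp add: af_pairing_fst pairing_gt_0_iff)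
    then have g': "?g \<in> P - pos_roots \<Phi> J"
      using g W unfolding pos_diff_iff by (simp add: weyl_inner_right)
    have "cl_rep \<Phi> \<Delta> lam n = min_rep \<Phi> \<Delta> J (w \<circ> refl ?g)"
      unfolding b(3) using W by (intro target g) simp
    moreover have "fst b \<in> P \<and> snd b = 0 \<or> - fst b \<in> P \<and> snd b = 1"
      using b wm T by (intro label_cases) (simp_all add: af_pairing_fst)
    moreover have "b = fin (fst b)" if "snd b = 0"
      using that by (simp add: fin_def prod_eq_iff)
    moreover have "b = (fst b, 1)" if "snd b = 1"
      using that by (simp add: prod_eq_iff)
    moreover have "cl b = fst b" "cl (b - \<delta>) = fst b"
      by (simp_all add: cl_def null_root_def)
    ultimately show ?thesis
      using g' W T qb_edge_up_iff[OF min g'] qb_edge_down_iff[OF min g'] unfolding fin_iff delta_iff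
      by auto
  qed
  \<comment> \<open>Both kinds of edges give \<open>T = 1\<close>, at \<delta>-coefficient
    \<open>0\<close> or \<open>1\<close>. That \<open>g\<close> is positive on \<open>lam\<close>
    makes the reflection lead upwards from \<open>m\<close>.\<close>
  have backward: "\<exists>n. lz_cover \<Phi> \<Delta> lam m n \<and> cover_label \<Phi> \<Delta> m n = b \<and>
      cl_rep \<Phi> \<Delta> lam n = min_rep \<Phi> \<Delta> J (w \<circ> refl g)"
    if g: "g \<in> P - pos_roots \<Phi> J" and b: "b \<in> af_pos_roots \<Phi> \<Delta>" "fst b = w g" and T: "T (w lam) b = 1"
    for g b
  proof -
    have root: "g \<in> \<Phi>" and pos: "0 < g \<bullet> lam"
      using g by (simp_all only: pos_diff_iff)
    have "0 < af_pairing b m"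
      using pos root_nonzero[OF weyl_root[OF W root]] weyl_inner[OF W, of g lam] b(2) wm
      by (simp add: af_pairing_fst pairing_gt_0_iff)
    then show ?thesis
      using T_and_covers[OF b(1)] T wm lz_cover_iff[OF m] cover_label_eq[OF b(1)] target[OF root b(2)]
      by (intro exI[of _ "af_refl b m"]) simp
  qed
  have up: "\<exists>n. lz_cover \<Phi> \<Delta> lam m n \<and> cover_label \<Phi> \<Delta> m n = fin (w g) \<and> cl_rep \<Phi> \<Delta> lam n = w'"
    if g: "g \<in> P - pos_roots \<Phi> J" and "qb_edge_up \<Phi> \<Delta> J w g w'" for g w'
  proof -
    have "w' = min_rep \<Phi> \<Delta> J (w \<circ> refl g)" "w g \<in> P" "T (w lam) (fin (w g)) = 1"
      using that(2) by (simp_all add: qb_edge_up_iff[OF min g])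
    then show ?thesis
      using backward[OF g, of "fin (w g)"] pos_subset by (auto simp: af_pos_roots_iff fin_def)
  qed
  have down: "\<exists>n. lz_cover \<Phi> \<Delta> lam m n \<and> cover_label \<Phi> \<Delta> m n = \<delta> + fin (w g) \<and> cl_rep \<Phi> \<Delta> lam n = w'"
    if g: "g \<in> P - pos_roots \<Phi> J" and "qb_edge_down \<Phi> \<Delta> J w g w'" for g w'
  proof -
    have "w' = min_rep \<Phi> \<Delta> J (w \<circ> refl g)" "T (w lam) (w g, 1) = 1"
      using that(2) by (simp_all add: qb_edge_down_iff[OF min g])
    moreover have "w g \<in> \<Phi>"
      using g pos_subset by (intro weyl_root[OF W]) blast
    ultimately show ?thesis
      using backward[OF g, of "(w g, 1)"] by (auto simp: af_pos_roots_iff fin_def null_root_def)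
  qed
  show ?thesis
    using forward up down by blast
qed

end

theorem theorem3p4:
  fixes \<Phi> \<Delta> J :: "'a::euclidean_space set"
    and lam :: 'a and \<mu> :: "'a \<times> real" and w :: "'a \<Rightarrow> 'a"
  assumes "irreducible_root_system \<Phi>"
    and "simple_roots \<Phi> \<Delta>"
    and "lam \<in> weight_lattice \<Phi>"
    and "dominant \<Delta> lam"
    and "J = singular_nodes \<Delta> lam"
    and "\<mu> \<in> lz_weights \<Phi> lam"
    and "w = cl_rep \<Phi> \<Delta> lam \<mu>"
  shows
    "(\<forall>\<nu> \<beta>. lz_cover \<Phi> \<Delta> lam \<mu> \<nu> \<and> \<beta> = cover_label \<Phi> \<Delta> \<mu> \<nu> \<longrightarrow>
       (\<beta> \<in> fin ` pos_roots \<Phi> \<Delta> \<or> \<beta> \<in> (\<lambda>\<alpha>. \<delta> - fin \<alpha>) ` pos_roots \<Phi> \<Delta>) \<and>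
       (\<beta> \<in> fin ` pos_roots \<Phi> \<Delta> \<longrightarrow>
          inv w (cl \<beta>) \<in> pos_roots \<Phi> \<Delta> - pos_roots \<Phi> J \<and>
          qb_edge_up \<Phi> \<Delta> J w (inv w (cl \<beta>)) (cl_rep \<Phi> \<Delta> lam \<nu>)) \<and>
       (\<beta> \<in> (\<lambda>\<alpha>. \<delta> - fin \<alpha>) ` pos_roots \<Phi> \<Delta> \<longrightarrow>
          inv w (cl (\<beta> - \<delta>)) \<in> pos_roots \<Phi> \<Delta> - pos_roots \<Phi> J \<and>
          qb_edge_down \<Phi> \<Delta> J w (inv w (cl (\<beta> - \<delta>))) (cl_rep \<Phi> \<Delta> lam \<nu>))) \<and>
    (\<forall>\<gamma> \<in> pos_roots \<Phi> \<Delta> - pos_roots \<Phi> J. \<forall>w'.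
       (qb_edge_up \<Phi> \<Delta> J w \<gamma> w' \<longrightarrow>
          (\<exists>\<nu>. lz_cover \<Phi> \<Delta> lam \<mu> \<nu> \<and> cover_label \<Phi> \<Delta> \<mu> \<nu> = fin (w \<gamma>) \<and>
               cl_rep \<Phi> \<Delta> lam \<nu> = w')) \<and>
       (qb_edge_down \<Phi> \<Delta> J w \<gamma> w' \<longrightarrow>
          (\<exists>\<nu>. lz_cover \<Phi> \<Delta> lam \<mu> \<nu> \<and> cover_label \<Phi> \<Delta> \<mu> \<nu> = \<delta> + fin (w \<gamma>) \<and>
               cl_rep \<Phi> \<Delta> lam \<nu> = w')))"
proof -
  interpret root_basis \<Phi> \<Delta>
    using assms by unfold_locales
  obtain S F where "affine_basis \<Phi> \<Delta> (af_pos_roots \<Phi> \<Delta>) S F"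
    by (rule affine_basis_affine)
  then interpret dominant_weight_affine \<Phi> \<Delta> lam S F
    using assms by (intro dominant_weight_affine.intro dominant_weight_affine_axioms.intro
        dominant_weight.intro dominant_weight_axioms.intro root_basis.intro)
  show ?thesis
    unfolding assms(5) using assms(6,7) by (rule quantum_bruhat_covers)
qed

end
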